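(* Let $p_1,\dots,p_n$ be $n$ distinct prime numbers, let $X$ be a set with $|X|=p_1\cdots p_n$, and let $G$ be a solvable transitive subgroup of $\mathrm{Sym}_X$. Then there exist $\sigma\in\mathrm{Sym}_n$ and normal subgroups $$\{1\}=K_0\subseteq T_1\subseteq K_1\subseteq T_2\subseteq K_2\subseteq\cdots\subseteq T_n\subseteq K_n=G$$ of $G$ such that for every $i=1,\dots,n$: (i) $K_i/K_{i-1}$ is isomorphic to a subgroup of $\left(\mathbb Z/(p_{\sigma(i)})\rtimes \mathrm{Aut}(\mathbb Z/(p_{\sigma(i)}))\right)^{m_i}$ with $m_i=\frac{p_1\cdots p_n}{p_{\sigma(1)}\cdots p_{\sigma(i)}}$, $p_{\sigma(i)}$ divides $|K_i/K_{i-1}|$, and $T_i/K_{i-1}$ is the Sylow $p_{\sigma(i)}$-subgroup of $K_i/K_{i-1}$; (ii) $K_i=\{g\in G : g(T_i(x))=T_i(x)\text{ for all }x\in X\}$, where $T_i(x)=\{t(x): t\in T_i\}$; (iii) $\mathcal S_i=\{K_i(x): x\in X\}$ (where $K_i(x)=\{g(x):g\in K_i\}$) is a system of imprimitivity of $G$ and $|\mathcal S_i|=\frac{p_1\cdots p_n}{p_{\sigma(1)}\cdots p_{\sigma(i)}}$.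
   Context: Here $\mathbb Z/(p)\rtimes\mathrm{Aut}(\mathbb Z/(p))$ is the holomorph of the cyclic group of order $p$ (the semidirect product with the natural action), and a power $H^m$ denotes the direct product of $m$ copies of $H$. A system of imprimitivity of a permutation group $G\le\mathrm{Sym}_X$ is a partition of $X$ into blocks such that each element of $G$ maps every block onto a block. *)

theory Defs
  imports "HOL-Algebra.Algebra" "HOL-Combinatorics.Permutations" "HOL-Library.Disjoint_Sets"
begin

definition semidirect_product ::
  "('n, 'c) monoid_scheme \<Rightarrow> ('h, 'd) monoid_scheme \<Rightarrow> ('h \<Rightarrow> 'n \<Rightarrow> 'n) \<Rightarrow> ('n \<times> 'h) monoid"
  where "semidirect_product N H act =
    \<lparr>carrier = carrier N \<times> carrier H,
     monoid.mult = (\<lambda>(n, h) (n', h'). (n \<otimes>\<^bsub>N\<^esub> act h n', h \<otimes>\<^bsub>H\<^esub> h')),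
     one = (\<one>\<^bsub>N\<^esub>, \<one>\<^bsub>H\<^esub>)\<rparr>"

definition holomorph :: "('n, 'c) monoid_scheme \<Rightarrow> ('n \<times> ('n \<Rightarrow> 'n)) monoid"
  where "holomorph N = semidirect_product N (AutoGroup N) (\<lambda>\<phi> x. \<phi> x)"

definition sylow_subgroup :: "('g, 'c) monoid_scheme \<Rightarrow> nat \<Rightarrow> 'g set \<Rightarrow> bool"
  where "sylow_subgroup G p P \<longleftrightarrow>
    subgroup P G \<and> (\<exists>a. card P = p ^ a \<and> \<not> p ^ Suc a dvd order G)"

definition orbit_of :: "('a \<Rightarrow> 'a) set \<Rightarrow> 'a \<Rightarrow> 'a set"
  where "orbit_of T x = (\<lambda>t. t x) ` T"

definition imprimitivity_system :: "'a set \<Rightarrow> ('a \<Rightarrow> 'a) set \<Rightarrow> 'a set set \<Rightarrow> bool"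
  where "imprimitivity_system \<Omega> H \<S> \<longleftrightarrow>
    partition_on \<Omega> \<S> \<and> (\<forall>g\<in>H. \<forall>B\<in>\<S>. g ` B \<in> \<S>)"

end

theory Submission
  imports Defs "HOL-Number_Theory.Residues" "HOL-Computational_Algebra.Squarefree"
begin

text \<open>
  Let \<open>K\<close> be normal in \<open>G\<close> and equal to the kernel of the action of \<open>G\<close> on the set \<open>\<B>\<close> of its
  orbits. The last term of the derived series not contained in \<open>K\<close> acts on \<open>\<B>\<close> through a nontrivial
  abelian group, and its elements whose \<open>q\<close>-th power lies in \<open>K\<close> form, for a suitable prime \<open>q\<close>,
  a normal subgroup \<open>P\<close> that acts nontrivially. Its orbits on \<open>\<B>\<close> have \<open>q\<close>-power length
  dividing the squarefree number \<open>card \<B>\<close>, hence length \<open>q\<close>. Let \<open>F\<close> be the group fixing every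
  \<open>P\<close>-orbit and \<open>T\<close> the subgroup of \<open>F\<close> commuting with \<open>P\<close> on \<open>\<B>\<close>. Labelling each \<open>P\<close>-orbit by
  \<open>\<int>/q\<close> through a generator, \<open>F\<close> acts by affine maps \<open>i \<mapsto> u * i + c\<close>, which embeds \<open>F / K\<close> in a
  power of the holomorph, and \<open>T\<close> consists of the elements with \<open>u = 1\<close> on every orbit. So \<open>T / K\<close>
  has exponent \<open>q\<close>, while by Fermat's little theorem \<open>F / T\<close> has no element of order \<open>q\<close>. The step
  is repeated with \<open>F\<close> in place of \<open>K\<close>.
\<close>

section \<open>Finite groups and the holomorph of a cyclic group of prime order\<close>

text \<open>Sylow's theorem provides a subgroup of order exactly \<open>q\<close>; any of its
  non-identity elements serves.\<close>

lemma (in group) cauchy_prime: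
  assumes "finite (carrier G)" "Factorial_Ring.prime q" "q dvd order G"
  obtains x where "x \<in> carrier G" "x \<noteq> \<one>" "x [^] q = \<one>"
proof -
  obtain m where "order G = q ^ 1 * m" using assms(3) by (auto simp: dvd_def)
  then obtain H where H: "subgroup H G" "card H = q ^ 1"
    using sylow_thm[OF assms(2) is_group _ assms(1)] by blast
  interpret H: group "G\<lparr>carrier := H\<rparr>" using H(1) by (rule subgroup_imp_group)
  have "card H > 1" using H(2) prime_gt_1_nat[OF assms(2)] by simp
  then obtain x where x: "x \<in> H" "x \<noteq> \<one>"
    by (metis card_le_Suc0_iff_eq One_nat_def card.infinite not_le not_less_zero H(1) subgroup.one_closed)
  have "x [^]\<^bsub>G\<lparr>carrier := H\<rparr>\<^esub> q = \<one>"
    using H.pow_order_eq_1[of x] x H(2) by (simp add: order_def)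
  then have "x [^] q = \<one>" by (simp flip: nat_pow_consistent)
  then show thesis using that x H(1) by (meson subgroup.mem_carrier)
qed

text \<open>For a prime divisor \<open>r\<close> of the order, Cauchy yields a non-identity element
  whose order divides both \<open>r\<close> and \<open>q\<close>, so \<open>r = q\<close>.\<close>

lemma (in group) order_exponent_prime:
  assumes "finite (carrier G)" "Factorial_Ring.prime q"
    and exp: "\<And>x. x \<in> carrier G \<Longrightarrow> x [^] q = \<one>"
  obtains a where "order G = q ^ a"
proof -
  have only: "r = q" if r: "Factorial_Ring.prime r" "r dvd order G" for r
  proof -
    obtain x where x: "x \<in> carrier G" "x \<noteq> \<one>" "x [^] r = \<one>"
      using cauchy_prime[OF assms(1) r] .
    then have "ord x dvd r" "ord x dvd q" using exp by (auto simp flip: pow_eq_id)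
    moreover have "ord x \<noteq> 1" using x by (metis ord_eq_1)
    ultimately show "r = q" using r(1) assms(2) by (metis prime_nat_iff)
  qed
  have "order G \<noteq> 0" using assms(1) by (simp add: order_gt_0_iff_finite[symmetric])
  moreover have "\<not> is_unit q" using assms(2) by auto
  ultimately obtain m where m: "order G = q ^ multiplicity q (order G) * m" "\<not> q dvd m"
    using multiplicity_decompose' by metis
  have "m = 1"
  proof (rule ccontr)
    assume "m \<noteq> 1"
    then obtain r where "Factorial_Ring.prime r" "r dvd m" using prime_factor_nat by blast
    then show False using only m by (metis dvd_mult)
  qed
  then show thesis using that m by simp
qed

lemma (in normal) order_Mod_exponent_prime:
  assumes "finite (carrier G)" "Factorial_Ring.prime q"
    and "\<And>x. x \<in> carrier G \<Longrightarrow> x [^] q \<in> H"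
  obtains a where "order (G Mod H) = q ^ a"
proof (rule group.order_exponent_prime[OF factorgroup_is_group _ assms(2)])
  show "finite (carrier (G Mod H))" using assms(1) by (simp add: carrier_FactGroup)
  fix C assume "C \<in> carrier (G Mod H)"
  then show "C [^]\<^bsub>G Mod H\<^esub> q = \<one>\<^bsub>G Mod H\<^esub>"
    using assms(3) by (auto simp: carrier_FactGroup FactGroup_pow is_subgroup coset_join2)
qed (use that in blast)

text \<open>By Cauchy in the quotient, divisibility would give a coset \<open>H #> x\<close> of
  order \<open>q\<close>, that is \<open>x [^] q\<close> in \<open>H\<close> with \<open>x\<close>
  outside \<open>H\<close>. Together with \<open>order_Mod_exponent_prime\<close> this reduces the
  Sylow property to statements about \<open>q\<close>-th powers of elements.\<close>

lemma (in normal) not_dvd_order_Mod: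
  assumes "finite (carrier G)" "Factorial_Ring.prime q"
    and "\<And>x. x \<in> carrier G \<Longrightarrow> x [^] q \<in> H \<Longrightarrow> x \<in> H"
  shows "\<not> q dvd order (G Mod H)"
proof
  assume "q dvd order (G Mod H)"
  moreover have "finite (carrier (G Mod H))" using assms(1) by (simp add: carrier_FactGroup)
  ultimately obtain C where C: "C \<in> carrier (G Mod H)" "C \<noteq> \<one>\<^bsub>G Mod H\<^esub>"
    "C [^]\<^bsub>G Mod H\<^esub> q = \<one>\<^bsub>G Mod H\<^esub>"
    using group.cauchy_prime[OF factorgroup_is_group _ assms(2)] by blast
  then obtain x where x: "x \<in> carrier G" "C = H #> x" by (auto simp: carrier_FactGroup)
  then have "H #> (x [^] q) = H" using C(3) by (simp add: FactGroup_pow)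
  then have "x [^] q \<in> H" using x(1) is_subgroup by (metis coset_join1 nat_pow_closed subset)
  then have "x \<in> H" using assms(3) x by blast
  then show False using x C(2) is_subgroup by (simp add: coset_join2)
qed

section \<open>The holomorph as a group\<close>

lemma carrier_holomorph: "carrier (holomorph N) = carrier N \<times> auto N"
  by (simp add: holomorph_def semidirect_product_def AutoGroup_def)

lemma mult_holomorph:
  assumes "h \<in> auto N" "h' \<in> auto N"
  shows "(n, h) \<otimes>\<^bsub>holomorph N\<^esub> (n', h') = (n \<otimes>\<^bsub>N\<^esub> h n', compose (carrier N) h h')"
  using assms by (simp add: holomorph_def semidirect_product_def AutoGroup_def BijGroup_def auto_def)

lemma one_holomorph: "\<one>\<^bsub>holomorph N\<^esub> = (\<one>\<^bsub>N\<^esub>, \<lambda>x\<in>carrier N. x)"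
  by (simp add: holomorph_def semidirect_product_def AutoGroup_def BijGroup_def)

lemma auto_closed: "h \<in> auto N \<Longrightarrow> n \<in> carrier N \<Longrightarrow> h n \<in> carrier N"
  by (auto simp: auto_def hom_def)

lemma (in group) compose_auto:
  "h \<in> auto G \<Longrightarrow> h' \<in> auto G \<Longrightarrow> compose (carrier G) h h' \<in> auto G"
  using subgroup.m_closed[OF subgroup_auto, of h h'] by (simp add: BijGroup_def auto_def)

lemma (in group) group_holomorph: "group (holomorph G)"
proof (rule groupI)
  fix x y assume "x \<in> carrier (holomorph G)" "y \<in> carrier (holomorph G)"
  then show "x \<otimes>\<^bsub>holomorph G\<^esub> y \<in> carrier (holomorph G)"
    by (auto simp: carrier_holomorph mult_holomorph auto_closed compose_auto)
next
  show "\<one>\<^bsub>holomorph G\<^esub> \<in> carrier (holomorph G)"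
    by (simp add: carrier_holomorph one_holomorph id_in_auto)
next
  fix x y z
  assume xyz: "x \<in> carrier (holomorph G)" "y \<in> carrier (holomorph G)" "z \<in> carrier (holomorph G)"
  obtain a h b k c l where [simp]: "x = (a, h)" "y = (b, k)" "z = (c, l)"
    by (metis surj_pair)
  have mem: "a \<in> carrier G" "b \<in> carrier G" "c \<in> carrier G" "h \<in> auto G" "k \<in> auto G" "l \<in> auto G"
    using xyz by (auto simp: carrier_holomorph)
  have "h (b \<otimes> k c) = h b \<otimes> h (k c)"
    using mem auto_closed[of k G c] unfolding auto_def hom_def by blast
  moreover have "compose (carrier G) (compose (carrier G) h k) l
      = compose (carrier G) h (compose (carrier G) k l)"
    using mem auto_closed[of l G] by (intro compose_assoc[symmetric] Pi_I) blast
  ultimately show "x \<otimes>\<^bsub>holomorph G\<^esub> y \<otimes>\<^bsub>holomorph G\<^esub> z = x \<otimes>\<^bsub>holomorph G\<^esub> (y \<otimes>\<^bsub>holomorph G\<^esub> z)"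
    using mem by (simp add: mult_holomorph compose_auto auto_closed m_assoc compose_eq del: compose_Id Id_compose)
next
  fix x assume x: "x \<in> carrier (holomorph G)"
  then obtain a h where [simp]: "x = (a, h)" and mem: "a \<in> carrier G" "h \<in> auto G"
    by (auto simp: carrier_holomorph)
  have ext: "h \<in> extensional (carrier G)" using mem by (simp add: auto_def Bij_def)
  have "h \<in> carrier G \<rightarrow> carrier G" using auto_closed[OF mem(2)] by blast
  then have "compose (carrier G) (\<lambda>x\<in>carrier G. x) h = h" using ext by (rule Id_compose)
  then show "\<one>\<^bsub>holomorph G\<^esub> \<otimes>\<^bsub>holomorph G\<^esub> x = x"
    using mem by (simp add: mult_holomorph one_holomorph id_in_auto)
  interpret A: group "AutoGroup G" by (rule AutoGroup)
  define k where "k = inv\<^bsub>AutoGroup G\<^esub> h"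
  have k: "k \<in> auto G" and kh: "compose (carrier G) k h = (\<lambda>x\<in>carrier G. x)"
    using A.inv_closed[of h] A.l_inv[of h] mem(2)
    by (auto simp: k_def AutoGroup_def BijGroup_def auto_def)
  \<comment> \<open>A left inverse suffices for \<open>groupI\<close>. Its second component must
    invert \<open>h\<close>, and the first component \<open>c\<close> must then solve
    \<open>c \<otimes> k a = \<one>\<close>.\<close>
  have "(inv (k a), k) \<in> carrier (holomorph G)"
    using k mem by (simp add: carrier_holomorph auto_closed)
  moreover have "(inv (k a), k) \<otimes>\<^bsub>holomorph G\<^esub> x = \<one>\<^bsub>holomorph G\<^esub>"
    using k mem kh by (simp add: mult_holomorph one_holomorph auto_closed)
  ultimately show "\<exists>y\<in>carrier (holomorph G). y \<otimes>\<^bsub>holomorph G\<^esub> x = \<one>\<^bsub>holomorph G\<^esub>" by blast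
qed

section \<open>Affine maps modulo a prime as elements of the holomorph\<close>

definition affine_perm :: "nat \<Rightarrow> (int \<Rightarrow> int) \<Rightarrow> bool"
  where "affine_perm q f \<longleftrightarrow>
    (\<exists>u c. \<not> int q dvd u \<and> (\<forall>i\<in>{0..<int q}. f i = (u * i + c) mod int q))"

text \<open>For \<open>f i = u * i + c\<close> this is the pair of the translation \<open>c\<close>
  and the multiplication by \<open>u\<close>. Both are read off from the values of \<open>f\<close>,
  so no choice of \<open>u\<close> and \<open>c\<close> enters. The restriction to
  \<open>{0..<int q}\<close> is there because members of \<open>auto\<close> are
  extensional.\<close>

definition affine_hol :: "nat \<Rightarrow> (int \<Rightarrow> int) \<Rightarrow> int \<times> (int \<Rightarrow> int)"
  where "affine_hol q f = (f 0, \<lambda>i\<in>{0..<int q}. (f i - f 0) mod int q)"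

lemma mult_mod_in_auto:
  assumes q: "Factorial_Ring.prime q" and u: "\<not> int q dvd u"
  shows "(\<lambda>i\<in>{0..<int q}. (u * i) mod int q) \<in> auto (integer_mod_group q)"
proof -
  let ?h = "\<lambda>i\<in>{0..<int q}. (u * i) mod int q"
  have q0: "q > 0" using q by (simp add: prime_gt_0_nat)
  then have C: "carrier (integer_mod_group q) = {0..<int q}" by (simp add: carrier_integer_mod_group)
  have "?h \<in> hom (integer_mod_group q) (integer_mod_group q)"
    using q0 by (auto simp: hom_def C mod_simps distrib_left)
  moreover have inj: "inj_on ?h {0..<int q}"
  proof (rule inj_onI)
    fix i j assume ij: "i \<in> {0..<int q}" "j \<in> {0..<int q}" "?h i = ?h j"
    then have "int q dvd u * (i - j)"
      by (simp add: right_diff_distrib mod_eq_dvd_iff)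
    then have "int q dvd i - j"
      using q u by (simp add: prime_dvd_mult_iff)
    then show "i = j" using ij by (auto simp flip: mod_eq_dvd_iff)
  qed
  moreover have "?h ` {0..<int q} \<subseteq> {0..<int q}" using q0 by auto
  ultimately show ?thesis
    using endo_inj_surj[of "{0..<int q}" ?h] by (simp add: auto_def Bij_def C bij_betw_def)
qed

lemma affine_perm_diff:
  assumes "i \<in> {0..<int q}" "\<forall>i\<in>{0..<int q}. f i = (u * i + c) mod int q"
  shows "(f i - f 0) mod int q = (u * i) mod int q"
proof -
  have "(0::int) \<in> {0..<int q}" using assms(1) by auto
  then show ?thesis using assms by (simp add: mod_simps)
qed

lemma affine_hol_closed:
  assumes q: "Factorial_Ring.prime q" and f: "affine_perm q f"
  shows "affine_hol q f \<in> carrier (holomorph (integer_mod_group q))"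
proof -
  have q0: "q > 0" using q by (simp add: prime_gt_0_nat)
  obtain u c where u: "\<not> int q dvd u" and f: "\<forall>i\<in>{0..<int q}. f i = (u * i + c) mod int q"
    using f by (auto simp: affine_perm_def)
  have "snd (affine_hol q f) = (\<lambda>i\<in>{0..<int q}. (u * i) mod int q)"
    using affine_perm_diff[OF _ f] by (auto simp: affine_hol_def)
  moreover have "f 0 \<in> {0..<int q}" using f q0 by simp
  ultimately show ?thesis
    using mult_mod_in_auto[OF q u] q0
    by (simp add: carrier_holomorph mem_Times_iff carrier_integer_mod_group affine_hol_def)
qed

text \<open>Composing affine maps follows the multiplication rule of the semidirect product: the
  translation part of the composite is \<open>f 0\<close> plus the linear part of \<open>f\<close>
  at \<open>g 0\<close>, and the linear parts compose.\<close>

lemma affine_hol_mult: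
  assumes q: "Factorial_Ring.prime q" and f: "affine_perm q f" and g: "affine_perm q g"
    and h: "\<And>i. i \<in> {0..<int q} \<Longrightarrow> h i = f (g i)"
  shows "affine_hol q h = affine_hol q f \<otimes>\<^bsub>holomorph (integer_mod_group q)\<^esub> affine_hol q g"
proof -
  have q0: "q > 0" using q by (simp add: prime_gt_0_nat)
  obtain u c where u: "\<forall>i\<in>{0..<int q}. f i = (u * i + c) mod int q"
    using f by (auto simp: affine_perm_def)
  obtain v d where v: "\<forall>i\<in>{0..<int q}. g i = (v * i + d) mod int q"
    using g by (auto simp: affine_perm_def)
  have gm: "g i \<in> {0..<int q}" if "i \<in> {0..<int q}" for i using v that q0 by simp
  have aut: "snd (affine_hol q f) \<in> auto (integer_mod_group q)" "snd (affine_hol q g) \<in> auto (integer_mod_group q)"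
    using affine_hol_closed[OF q f] affine_hol_closed[OF q g]
    by (auto simp: carrier_holomorph mem_Times_iff)
  have z: "(0::int) \<in> {0..<int q}" using q0 by simp
  have "h 0 = (f 0 + (f (g 0) - f 0) mod int q) mod int q"
    using h[OF z] u gm[OF z] by (simp add: mod_simps add.commute)
  moreover have "(\<lambda>i\<in>{0..<int q}. (h i - h 0) mod int q)
     = compose {0..<int q} (\<lambda>i\<in>{0..<int q}. (f i - f 0) mod int q) (\<lambda>i\<in>{0..<int q}. (g i - g 0) mod int q)"
  proof (rule ext, goal_cases)
    case (1 i)
    show ?case
    proof (cases "i \<in> {0..<int q}")
      case True
      let ?j = "(g i - g 0) mod int q"
      have j: "?j \<in> {0..<int q}" using q0 by simp
      have "(f ?j - f 0) mod int q = (u * (g i - g 0)) mod int q"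
        using affine_perm_diff[OF j u] by (simp add: mod_simps)
      also have "\<dots> = (f (g i) - f (g 0)) mod int q"
        using u gm[OF True] gm[OF z] by (simp add: mod_simps right_diff_distrib)
      finally show ?thesis using True h[OF True] h[OF z] j by (simp add: compose_def)
    qed (auto simp: compose_def)
  qed
  ultimately show ?thesis
    using mult_holomorph[OF aut, of "f 0" "g 0"] q0 z gm[OF z]
    by (simp add: affine_hol_def carrier_integer_mod_group)
qed

lemma affine_hol_eq_one_iff:
  assumes q: "Factorial_Ring.prime q" and f: "affine_perm q f"
  shows "affine_hol q f = \<one>\<^bsub>holomorph (integer_mod_group q)\<^esub> \<longleftrightarrow> (\<forall>i\<in>{0..<int q}. f i = i)"
proof -
  have q0: "q > 0" using q by (simp add: prime_gt_0_nat)
  have fm: "f i \<in> {0..<int q}" if "i \<in> {0..<int q}" for i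
    using f that q0 by (auto simp: affine_perm_def)
  show ?thesis
  proof
    assume "affine_hol q f = \<one>\<^bsub>holomorph (integer_mod_group q)\<^esub>"
    then have 1: "f 0 = 0" and 2: "(\<lambda>i\<in>{0..<int q}. (f i - f 0) mod int q) = (\<lambda>i\<in>{0..<int q}. i)"
      using q0 by (auto simp: affine_hol_def one_holomorph carrier_integer_mod_group)
    show "\<forall>i\<in>{0..<int q}. f i = i"
    proof
      fix i assume "i \<in> {0..<int q}"
      then show "f i = i" using fun_cong[OF 2, of i] 1 fm[of i] by simp
    qed
  next
    assume "\<forall>i\<in>{0..<int q}. f i = i"
    then show "affine_hol q f = \<one>\<^bsub>holomorph (integer_mod_group q)\<^esub>"
      using q0 by (auto simp: affine_hol_def one_holomorph carrier_integer_mod_group)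
  qed
qed

section \<open>Finite transitive actions\<close>

text \<open>The action is abstract and possibly unfaithful, so that the same results apply to
  \<open>G\<close> acting on the original points and to \<open>G\<close> acting on a set of
  blocks.\<close>

locale finite_transitive_action = transitive_action G E \<phi> + group G
  for G (structure) and E :: "'b set" and \<phi> +
  assumes finite_group: "finite (carrier G)" and finite_set: "finite E"
begin

abbreviation orb :: "'a set \<Rightarrow> 'b \<Rightarrow> 'b set"
  where "orb N x \<equiv> orbit (G\<lparr>carrier := N\<rparr>) \<phi> x"

definition act_kernel :: "'a set"
  where "act_kernel = {g \<in> carrier G. \<forall>x\<in>E. \<phi> g x = x}"

text \<open>For normal \<open>N\<close> this is the kernel of the action of \<open>G\<close> on the
  set of \<open>N\<close>-orbits; the pointwise form is easier to check, and
  \<open>orbit_fixer_iff\<close> gives the setwise one.\<close>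

definition orbit_fixer :: "'a set \<Rightarrow> 'a set"
  where "orbit_fixer N = {g \<in> carrier G. \<forall>x\<in>E. \<phi> g x \<in> orb N x}"

text \<open>Commutation is demanded of the induced maps on \<open>E\<close> only, so this is a
  centralizer modulo \<open>act_kernel\<close> and may be larger than the centralizer of
  \<open>N\<close> inside \<open>orbit_fixer N\<close>.\<close>

definition act_centralizer :: "'a set \<Rightarrow> 'a set"
  where "act_centralizer N =
    {g \<in> orbit_fixer N. \<forall>p\<in>N. \<forall>x\<in>E. \<phi> g (\<phi> p x) = \<phi> p (\<phi> g x)}"

lemma act_closed: "g \<in> carrier G \<Longrightarrow> x \<in> E \<Longrightarrow> \<phi> g x \<in> E"
  by (rule element_image[OF _ _ refl])

lemma act_one: "x \<in> E \<Longrightarrow> \<phi> \<one> x = x"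
  by (metis id_eq_one restrict_apply')

lemma act_inv: "g \<in> carrier G \<Longrightarrow> x \<in> E \<Longrightarrow> \<phi> (inv g) (\<phi> g x) = x"
  by (rule orbit_sym_aux[OF _ _ refl])

lemma act_inv': "g \<in> carrier G \<Longrightarrow> x \<in> E \<Longrightarrow> \<phi> g (\<phi> (inv g) x) = x"
  using act_inv[of "inv g" x] by simp

lemma act_cancel: "g \<in> carrier G \<Longrightarrow> x \<in> E \<Longrightarrow> y \<in> E \<Longrightarrow> \<phi> g x = \<phi> g y \<longleftrightarrow> x = y"
  by (rule inj_on_eq_iff[OF inj_prop])

lemma orb_iff: "y \<in> orb N x \<longleftrightarrow> (\<exists>g\<in>N. y = \<phi> g x)"
  by (auto simp: orbit_def)

lemma orb_closed: "N \<subseteq> carrier G \<Longrightarrow> x \<in> E \<Longrightarrow> y \<in> orb N x \<Longrightarrow> y \<in> E"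
  using act_closed unfolding orb_iff by blast

lemma orb_eq:
  assumes "subgroup N G" "x \<in> E" "y \<in> orb N x"
  shows "orb N y = orb N x"
proof -
  interpret N: group_action "G\<lparr>carrier := N\<rparr>" E \<phi> by (rule induced_action[OF assms(1)])
  have sub: "N \<subseteq> carrier G" by (rule subgroup.subset[OF assms(1)])
  have y: "y \<in> E" using orb_closed[OF sub assms(2,3)] .
  have x: "x \<in> orb N y" using N.orbit_sym[OF assms(2) y assms(3)] .
  show ?thesis
  proof (intro equalityI subsetI)
    fix z assume z: "z \<in> orb N y"
    show "z \<in> orb N x" by (rule N.orbit_trans[OF assms(2) y orb_closed[OF sub y z] assms(3) z])
  next
    fix z assume z: "z \<in> orb N x"
    show "z \<in> orb N y" by (rule N.orbit_trans[OF y assms(2) orb_closed[OF sub assms(2) z] x z])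
  qed
qed

lemma orb_self: "subgroup N G \<Longrightarrow> x \<in> E \<Longrightarrow> x \<in> orb N x"
  by (rule group_action.orbit_refl[OF induced_action])

lemma act_image_orb:
  assumes "N \<lhd> G" "g \<in> carrier G" "x \<in> E"
  shows "\<phi> g ` orb N x = orb N (\<phi> g x)"
proof -
  interpret N: normal N G by (rule assms(1))
  show ?thesis
  proof (intro equalityI subsetI)
    fix y assume "y \<in> \<phi> g ` orb N x"
    then obtain h where h: "h \<in> N" "y = \<phi> g (\<phi> h x)" by (auto simp: orb_iff)
    have "y = \<phi> (g \<otimes> h \<otimes> inv g) (\<phi> g x)"
      using h assms by (simp add: composition_rule act_closed act_inv)
    then show "y \<in> orb N (\<phi> g x)" using N.inv_op_closed2[OF assms(2) h(1)] by (auto simp: orb_iff)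
  next
    fix y assume "y \<in> orb N (\<phi> g x)"
    then obtain h where h: "h \<in> N" "y = \<phi> h (\<phi> g x)" by (auto simp: orb_iff)
    have "y = \<phi> g (\<phi> (inv g \<otimes> h \<otimes> g) x)"
      using h assms by (simp add: composition_rule act_closed act_inv')
    then show "y \<in> \<phi> g ` orb N x"
      using N.inv_op_closed1[OF assms(2) h(1)] orb_iff[of _ N x] image_eqI[of y "\<phi> g"] by metis
  qed
qed

lemma card_orb_eq:
  assumes "N \<lhd> G" "x \<in> E" "y \<in> E"
  shows "card (orb N x) = card (orb N y)"
proof -
  obtain g where g: "g \<in> carrier G" "\<phi> g x = y" using unique_orbit assms by blast
  have "orb N x \<subseteq> E" using assms orb_closed normal_imp_subgroup subgroup.subset by blast
  then have "inj_on (\<phi> g) (orb N x)" using inj_prop[OF g(1)] inj_on_subset by blast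
  then show ?thesis using act_image_orb[OF assms(1) g(1) assms(2)] g(2) card_image by metis
qed

lemma card_orb_mult_card_orbits:
  assumes "N \<lhd> G" "x \<in> E"
  shows "card (orbits (G\<lparr>carrier := N\<rparr>) E \<phi>) * card (orb N x) = card E"
proof -
  have N: "subgroup N G" using assms(1) normal_imp_subgroup by blast
  interpret N: group_action "G\<lparr>carrier := N\<rparr>" E \<phi> by (rule induced_action[OF N])
  have "card E = (\<Sum>B\<in>orbits (G\<lparr>carrier := N\<rparr>) E \<phi>. \<Sum>x\<in>B. 1)"
    using N.disjoint_sum[OF finite_set, of "\<lambda>_. 1::nat"] by simp
  also have "\<dots> = (\<Sum>B\<in>orbits (G\<lparr>carrier := N\<rparr>) E \<phi>. card (orb N x))"
  proof (rule sum.cong[OF refl])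
    fix B assume "B \<in> orbits (G\<lparr>carrier := N\<rparr>) E \<phi>"
    then obtain y where "y \<in> E" "B = orb N y" by (auto simp: orbits_def)
    then show "(\<Sum>x\<in>B. 1) = card (orb N x)" using card_orb_eq[OF assms(1) _ assms(2)] by simp
  qed
  finally show ?thesis by simp
qed

section \<open>Normality of the kernel, the orbit fixer and the centralizer\<close>

lemma normal_act_kernel: "act_kernel \<lhd> G"
proof (rule normal_invI)
  show "subgroup act_kernel G"
  proof (rule subgroupI)
    have "\<one> \<in> act_kernel" by (simp add: act_kernel_def act_one)
    then show "act_kernel \<noteq> {}" by blast
    fix g assume g: "g \<in> act_kernel"
    then have "\<phi> (inv g) x = x" if "x \<in> E" for x
      using act_inv[of g x] that by (simp add: act_kernel_def)
    then show "inv g \<in> act_kernel" using g by (simp add: act_kernel_def)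
    fix h assume "h \<in> act_kernel"
    then show "g \<otimes> h \<in> act_kernel" using g by (simp add: act_kernel_def composition_rule)
  qed (auto simp: act_kernel_def)
qed (simp add: act_kernel_def composition_rule act_closed act_inv')

text \<open>An element of \<open>G\<close> permutes the \<open>N\<close>-orbits, and these are equal
  or disjoint, so keeping one point inside its orbit already maps that orbit onto itself.\<close>

lemma orbit_fixer_iff:
  assumes "N \<lhd> G"
  shows "orbit_fixer N = {g \<in> carrier G. \<forall>x\<in>E. \<phi> g ` orb N x = orb N x}"
proof -
  have N: "subgroup N G" by (rule normal_imp_subgroup[OF assms])
  have "\<phi> g x \<in> orb N x \<longleftrightarrow> \<phi> g ` orb N x = orb N x" if "g \<in> carrier G" "x \<in> E" for g x
    using act_image_orb[OF assms that] orb_eq[OF N that(2)] orb_self[OF N act_closed[OF that]]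
    by metis
  then show ?thesis unfolding orbit_fixer_def by blast
qed

lemma orbit_fixer_orb:
  assumes "subgroup N G" "g \<in> orbit_fixer N" "x \<in> E" "y \<in> orb N x"
  shows "\<phi> g y \<in> orb N x"
proof -
  have "y \<in> E" using assms orb_closed subgroup.subset by blast
  then have "\<phi> g y \<in> orb N y" using assms(2) by (simp add: orbit_fixer_def)
  then show ?thesis unfolding orb_eq[OF assms(1,3,4)] .
qed

lemma subset_orbit_fixer: "subgroup N G \<Longrightarrow> N \<subseteq> orbit_fixer N"
  using subgroup.subset[of N G] unfolding orbit_fixer_def orb_iff by blast

lemma normal_orbit_fixer:
  assumes "N \<lhd> G"
  shows "orbit_fixer N \<lhd> G"
proof (rule normal_invI)
  have N: "subgroup N G" by (rule normal_imp_subgroup[OF assms])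
  show "subgroup (orbit_fixer N) G"
  proof (rule subgroupI)
    show "orbit_fixer N \<noteq> {}"
      using subset_orbit_fixer[OF N] subgroup.one_closed[OF N] by blast
    fix g assume g: "g \<in> orbit_fixer N"
    have "\<phi> (inv g) x \<in> orb N x" if "x \<in> E" for x
    proof -
      have y: "\<phi> (inv g) x \<in> E" using that g by (simp add: act_closed orbit_fixer_def)
      then have "x \<in> orb N (\<phi> (inv g) x)"
        using g that by (auto simp: orbit_fixer_def) (metis act_inv')
      then show ?thesis using orb_eq[OF N y] orb_self[OF N y] by blast
    qed
    then show "inv g \<in> orbit_fixer N" using g by (simp add: orbit_fixer_def)
    fix h assume h: "h \<in> orbit_fixer N"
    have "\<phi> (g \<otimes> h) x \<in> orb N x" if "x \<in> E" for x
      using orbit_fixer_orb[OF N g that] h g that by (simp add: orbit_fixer_def composition_rule)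
    then show "g \<otimes> h \<in> orbit_fixer N" using g h by (simp add: orbit_fixer_def)
  qed (auto simp: orbit_fixer_def)
  fix g h assume g: "g \<in> carrier G" and h: "h \<in> orbit_fixer N"
  have "\<phi> (g \<otimes> h \<otimes> inv g) x \<in> orb N x" if x: "x \<in> E" for x
  proof -
    have y: "\<phi> (inv g) x \<in> E" using g x by (simp add: act_closed)
    have "\<phi> g (\<phi> h (\<phi> (inv g) x)) \<in> \<phi> g ` orb N (\<phi> (inv g) x)"
      using h y by (simp add: orbit_fixer_def)
    also have "\<dots> = orb N x" using act_image_orb[OF assms g y] act_inv'[OF g x] by simp
    finally show ?thesis using g h x y by (simp add: composition_rule orbit_fixer_def)
  qed
  then show "g \<otimes> h \<otimes> inv g \<in> orbit_fixer N" using g h by (simp add: orbit_fixer_def)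
qed

lemma act_centralizerD:
  assumes "g \<in> act_centralizer N"
  shows "g \<in> orbit_fixer N" "g \<in> carrier G" "p \<in> N \<Longrightarrow> x \<in> E \<Longrightarrow> \<phi> g (\<phi> p x) = \<phi> p (\<phi> g x)"
  using assms unfolding act_centralizer_def orbit_fixer_def by blast+

lemma act_centralizerI:
  assumes "g \<in> orbit_fixer N" "\<And>p x. p \<in> N \<Longrightarrow> x \<in> E \<Longrightarrow> \<phi> g (\<phi> p x) = \<phi> p (\<phi> g x)"
  shows "g \<in> act_centralizer N"
  using assms unfolding act_centralizer_def by blast

lemma normal_act_centralizer:
  assumes "N \<lhd> G"
  shows "act_centralizer N \<lhd> G"
proof (rule normal_invI)
  interpret N: normal N G by (rule assms)
  interpret F: normal "orbit_fixer N" G by (rule normal_orbit_fixer[OF assms])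
  show "subgroup (act_centralizer N) G"
  proof (rule subgroupI)
    show "act_centralizer N \<subseteq> carrier G" using act_centralizerD by blast
    have "\<one> \<in> act_centralizer N"
      by (rule act_centralizerI) (simp_all add: act_one act_closed N.mem_carrier)
    then show "act_centralizer N \<noteq> {}" by blast
    fix g assume g: "g \<in> act_centralizer N"
    note gG = act_centralizerD(2)[OF g]
    have "\<phi> (inv g) (\<phi> p x) = \<phi> p (\<phi> (inv g) x)" if "p \<in> N" "x \<in> E" for p x
    proof -
      have "\<phi> g (\<phi> p (\<phi> (inv g) x)) = \<phi> p x"
        using act_centralizerD(3)[OF g that(1), of "\<phi> (inv g) x"] that gG
        by (simp add: act_closed act_inv')
      then show ?thesis
        using that gG by (metis N.mem_carrier act_closed act_inv inv_closed)
    qed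
    then show "inv g \<in> act_centralizer N"
      using act_centralizerD(1)[OF g] by (intro act_centralizerI) simp_all
    fix h assume h: "h \<in> act_centralizer N"
    note hG = act_centralizerD(2)[OF h]
    have "\<phi> (g \<otimes> h) (\<phi> p x) = \<phi> p (\<phi> (g \<otimes> h) x)" if "p \<in> N" "x \<in> E" for p x
      using act_centralizerD(3)[OF h that] act_centralizerD(3)[OF g that(1), of "\<phi> h x"] that gG hG
      by (simp add: composition_rule act_closed N.mem_carrier)
    then show "g \<otimes> h \<in> act_centralizer N"
      using act_centralizerD(1)[OF g] act_centralizerD(1)[OF h] by (intro act_centralizerI) simp_all
  qed
  fix g h assume g: "g \<in> carrier G" and h: "h \<in> act_centralizer N"
  note hG = act_centralizerD(2)[OF h]
  have "\<phi> (g \<otimes> h \<otimes> inv g) (\<phi> p x) = \<phi> p (\<phi> (g \<otimes> h \<otimes> inv g) x)" if "p \<in> N" "x \<in> E" for p x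
  proof -
    \<comment> \<open>Commutation of the conjugate of \<open>h\<close> with \<open>p\<close> is
      commutation of \<open>h\<close> with the conjugate \<open>?p\<close>, which again lies in
      \<open>N\<close>.\<close>
    let ?p = "inv g \<otimes> p \<otimes> g"
    have p: "?p \<in> N" using N.inv_op_closed1 g that by blast
    have pG: "p \<in> carrier G" using that by simp
    have y: "\<phi> (inv g) x \<in> E" using g that by (simp add: act_closed)
    have "\<phi> (inv g) (\<phi> p x) = \<phi> ?p (\<phi> (inv g) x)"
      using g pG that by (simp add: composition_rule act_closed act_inv')
    then have "\<phi> h (\<phi> (inv g) (\<phi> p x)) = \<phi> ?p (\<phi> h (\<phi> (inv g) x))"
      using act_centralizerD(3)[OF h p y] by simp
    then have "\<phi> g (\<phi> h (\<phi> (inv g) (\<phi> p x))) = \<phi> p (\<phi> g (\<phi> h (\<phi> (inv g) x)))"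
      using g pG hG y by (simp add: composition_rule act_closed act_inv')
    then show ?thesis using g hG pG that by (simp add: composition_rule act_closed)
  qed
  then show "g \<otimes> h \<otimes> inv g \<in> act_centralizer N"
    using F.inv_op_closed2[OF g act_centralizerD(1)[OF h]] by (rule act_centralizerI[rotated])
qed

lemma act_kernel_subset_centralizer:
  assumes "N \<lhd> G"
  shows "act_kernel \<subseteq> act_centralizer N"
proof
  interpret N: normal N G by (rule assms)
  fix g assume "g \<in> act_kernel"
  then have g: "g \<in> carrier G" "\<And>x. x \<in> E \<Longrightarrow> \<phi> g x = x" by (simp_all add: act_kernel_def)
  show "g \<in> act_centralizer N"
  proof (rule act_centralizerI)
    show "g \<in> orbit_fixer N" using g orb_self[OF N.is_subgroup] by (simp add: orbit_fixer_def)
  qed (simp add: g act_closed N.mem_carrier)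
qed

end

section \<open>Normal subgroups acting with orbits of prime length\<close>

text \<open>Only the image of \<open>P\<close> in the permutations of \<open>E\<close> is elementary
  abelian: commutativity and exponent \<open>q\<close> are required of the action, not of
  \<open>P\<close> itself.\<close>

locale elementary_abelian_action = finite_transitive_action +
  fixes P and q :: nat
  assumes normal_P: "P \<lhd> G"
    and prime_q: "Factorial_Ring.prime q"
    and act_commute: "\<And>p r x. p \<in> P \<Longrightarrow> r \<in> P \<Longrightarrow> x \<in> E \<Longrightarrow> \<phi> p (\<phi> r x) = \<phi> r (\<phi> p x)"
    and act_exponent: "\<And>p x. p \<in> P \<Longrightarrow> x \<in> E \<Longrightarrow> \<phi> (p [^] q) x = x"
    and nonempty: "E \<noteq> {}"
    and card_orb: "\<And>x. x \<in> E \<Longrightarrow> card (orb P x) = q"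
begin

sublocale P: normal P G by (rule normal_P)

lemma pow_P: "p \<in> P \<Longrightarrow> p [^] (n::nat) \<in> P"
  by (induction n) (auto intro: P.m_closed)

lemma orb_P_closed: "x \<in> E \<Longrightarrow> y \<in> orb P x \<Longrightarrow> y \<in> E"
  by (rule orb_closed[OF P.subset])

lemma act_pow_add:
  "p \<in> carrier G \<Longrightarrow> x \<in> E \<Longrightarrow> \<phi> (p [^] (m + n :: nat)) x = \<phi> (p [^] m) (\<phi> (p [^] n) x)"
  by (simp add: composition_rule flip: nat_pow_mult)

lemma act_pow_mod:
  assumes "p \<in> P" "x \<in> E"
  shows "\<phi> (p [^] (n mod q)) x = \<phi> (p [^] n) x"
proof -
  have p: "p \<in> carrier G" using assms by simp
  have "\<phi> (p [^] (q * k)) x = x" for k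
  proof (induction k)
    case (Suc k)
    then show ?case using act_pow_add[OF p assms(2), of q "q * k"] act_exponent[OF assms] by simp
  qed (simp add: act_one assms)
  then show ?thesis
    using act_pow_add[OF p assms(2), of "n mod q" "q * (n div q)"] by simp
qed

text \<open>If the powers \<open>m\<close> and \<open>n\<close> agreed at \<open>x\<close> with
  \<open>q\<close> not dividing the difference, then \<open>p [^] (n - m)\<close> would fix
  \<open>x\<close>. The difference is invertible modulo \<open>q\<close>, so a power of this element
  acts on \<open>x\<close> as \<open>p\<close>, and \<open>p\<close> would fix
  \<open>x\<close>.\<close>

lemma act_pow_eq_iff:
  assumes p: "p \<in> P" and x: "x \<in> E" and ne: "\<phi> p x \<noteq> x"
  shows "\<phi> (p [^] m) x = \<phi> (p [^] n) x \<longleftrightarrow> [m = n] (mod q)"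
proof
  have pG: "p \<in> carrier G" using p by simp
  have *: "[m = n] (mod q)" if le: "m \<le> n" and eq: "\<phi> (p [^] m) x = \<phi> (p [^] n) x" for m n
  proof (rule ccontr)
    assume "\<not> [m = n] (mod q)"
    then have "\<not> q dvd n - m" using le by (metis cong_altdef_nat cong_sym)
    then have "coprime (n - m) q"
      using prime_q by (metis coprime_commute prime_imp_coprime_nat)
    then obtain v where v: "[(n - m) * v = 1] (mod q)" using cong_solve_coprime_nat by auto
    have "\<phi> (p [^] m) (\<phi> (p [^] (n - m)) x) = \<phi> (p [^] m) x"
      using act_pow_add[OF pG x, of m "n - m"] le eq by simp
    then have fix1: "\<phi> (p [^] (n - m)) x = x"
      using pG x by (simp add: act_cancel act_closed)
    have "\<phi> (p [^] ((n - m) * k)) x = x" for k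
    proof (induction k)
      case (Suc k)
      then show ?case using act_pow_add[OF pG x, of "n - m" "(n - m) * k"] fix1 by simp
    qed (simp add: act_one x)
    then have "\<phi> (p [^] (1::nat)) x = x"
      using act_pow_mod[OF p x, of "(n - m) * v"] act_pow_mod[OF p x, of 1] v
      by (metis cong_def)
    then show False using ne pG by simp
  qed
  show "[m = n] (mod q)" if "\<phi> (p [^] m) x = \<phi> (p [^] n) x"
    using *[of m n] *[of n m] that by (metis cong_sym nat_le_linear)
  show "\<phi> (p [^] m) x = \<phi> (p [^] n) x" if "[m = n] (mod q)"
    using act_pow_mod[OF p x] that by (metis cong_def)
qed

section \<open>Labelling an orbit by the exponents of a generator\<close>

lemma ex_moving:
  assumes "x \<in> E"
  shows "\<exists>p\<in>P. \<phi> p x \<noteq> x"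
proof (rule ccontr)
  assume "\<not> ?thesis"
  then have "orb P x \<subseteq> {x}" by (auto simp: orb_iff)
  then have "card (orb P x) \<le> 1" using card_mono[of "{x}"] by fastforce
  then show False using card_orb[OF assms] prime_gt_1_nat[OF prime_q] by simp
qed

text \<open>Any element of \<open>P\<close> that moves \<open>x\<close> acts on the orbit of
  \<open>x\<close> as a \<open>q\<close>-cycle. It is chosen separately for every base point, so the
  labellings of different orbits are unrelated.\<close>

definition gen :: "'c \<Rightarrow> 'a"
  where "gen x = (SOME p. p \<in> P \<and> \<phi> p x \<noteq> x)"

lemma gen:
  assumes "x \<in> E"
  shows "gen x \<in> P" "\<phi> (gen x) x \<noteq> x"
  using someI_ex[of "\<lambda>p. p \<in> P \<and> \<phi> p x \<noteq> x"] ex_moving[OF assms] unfolding gen_def by blast+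

text \<open>Since \<open>P\<close> acts commutatively and is transitive on its orbit, an element of
  \<open>P\<close> fixing one point of the orbit fixes all of them.\<close>

lemma gen_moves:
  assumes "x \<in> E" "y \<in> orb P x"
  shows "\<phi> (gen x) y \<noteq> y"
proof
  obtain r where r: "r \<in> P" "y = \<phi> r x" using assms by (auto simp: orb_iff)
  assume "\<phi> (gen x) y = y"
  then have "\<phi> r (\<phi> (gen x) x) = \<phi> r x"
    using r act_commute[OF gen(1)[OF assms(1)] r(1) assms(1)] by simp
  then show False
    using gen[OF assms(1)] assms(1) r(1) by (simp add: act_cancel act_closed)
qed

definition lab :: "'c \<Rightarrow> nat \<Rightarrow> 'c"
  where "lab x n = \<phi> (gen x [^] n) x"

definition idx :: "'c \<Rightarrow> 'c \<Rightarrow> nat"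
  where "idx x = inv_into {..<q} (lab x)"

lemma lab_in_orb: "x \<in> E \<Longrightarrow> lab x n \<in> orb P x"
  using pow_P[OF gen(1)] unfolding lab_def orb_iff by blast

lemma q_pos: "q > 0"
  using prime_q by (simp add: prime_gt_0_nat)

lemma bij_lab:
  assumes "x \<in> E"
  shows "bij_betw (lab x) {..<q} (orb P x)"
proof -
  have inj: "inj_on (lab x) {..<q}"
  proof (rule inj_onI)
    fix i j assume ij: "i \<in> {..<q}" "j \<in> {..<q}" and "lab x i = lab x j"
    then have "[i = j] (mod q)"
      using act_pow_eq_iff[OF gen(1) _ gen(2)] assms by (simp add: lab_def)
    then show "i = j" using ij by (simp add: cong_def)
  qed
  moreover have "lab x ` {..<q} = orb P x"
  proof (rule card_subset_eq)
    show "lab x ` {..<q} \<subseteq> orb P x" using lab_in_orb[OF assms] by blast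
    show "finite (orb P x)"
      using orb_P_closed[OF assms] finite_set by (meson finite_subset subsetI)
    show "card (lab x ` {..<q}) = card (orb P x)"
      using card_image[OF inj] card_orb[OF assms] by simp
  qed
  ultimately show ?thesis by (simp add: bij_betw_def)
qed

lemma idx_less: "x \<in> E \<Longrightarrow> y \<in> orb P x \<Longrightarrow> idx x y < q"
  using bij_lab inv_into_into[of y "lab x" "{..<q}"] by (auto simp: idx_def bij_betw_def)

lemma lab_idx: "x \<in> E \<Longrightarrow> y \<in> orb P x \<Longrightarrow> lab x (idx x y) = y"
  using bij_lab unfolding idx_def by (metis bij_betw_inv_into_right)

lemma lab_mod: "x \<in> E \<Longrightarrow> lab x (n mod q) = lab x n"
  unfolding lab_def by (rule act_pow_mod[OF gen(1)])

lemma idx_lab: "x \<in> E \<Longrightarrow> idx x (lab x n) = n mod q"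
  using bij_lab q_pos lab_mod[of x n] unfolding idx_def
  by (metis bij_betw_inv_into_left lessThan_iff mod_less_divisor)

text \<open>The exponent is the label of \<open>\<phi> p x\<close>. Then \<open>p\<close> and the
  power of \<open>gen x\<close> agree at \<open>x\<close>, and commutativity carries the agreement
  to every other point of the orbit.\<close>

lemma P_on_orb:
  assumes "x \<in> E" "p \<in> P"
  obtains n :: nat where "\<And>y. y \<in> orb P x \<Longrightarrow> \<phi> p y = \<phi> (gen x [^] n) y"
proof -
  have "\<phi> p x \<in> orb P x" using assms by (auto simp: orb_iff)
  then have n: "\<phi> p x = \<phi> (gen x [^] idx x (\<phi> p x)) x"
    using lab_idx[OF assms(1)] by (simp add: lab_def)
  have "\<phi> p y = \<phi> (gen x [^] idx x (\<phi> p x)) y" if "y \<in> orb P x" for y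
  proof -
    obtain r where r: "r \<in> P" "y = \<phi> r x" using \<open>y \<in> orb P x\<close> by (auto simp: orb_iff)
    have "\<phi> p y = \<phi> r (\<phi> p x)" using act_commute[OF assms(2) r(1) assms(1)] r by simp
    also have "\<dots> = \<phi> r (\<phi> (gen x [^] idx x (\<phi> p x)) x)" using n by simp
    also have "\<dots> = \<phi> (gen x [^] idx x (\<phi> p x)) y"
      using act_commute[OF pow_P[OF gen(1)[OF assms(1)]] r(1) assms(1)] r by simp
    finally show ?thesis .
  qed
  then show thesis using that by blast
qed

text \<open>As \<open>P\<close> is normal, conjugating \<open>gen x\<close> by \<open>k\<close>
  gives an element of \<open>P\<close>, which acts on the orbit as a power of \<open>gen x\<close>.
  Its exponent \<open>u\<close> is the linear part of the affine map that \<open>k\<close> induces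
  on labels.\<close>

lemma fixer_on_orb:
  assumes x: "x \<in> E" and k: "k \<in> orbit_fixer P"
  obtains u :: nat where "\<not> q dvd u"
    "\<And>(n::nat) y. y \<in> orb P x \<Longrightarrow> \<phi> k (\<phi> (gen x [^] n) y) = \<phi> (gen x [^] (u * n)) (\<phi> k y)"
proof -
  let ?a = "gen x"
  have a: "?a \<in> P" "?a \<in> carrier G" using gen(1)[OF x] by simp_all
  have kG: "k \<in> carrier G" using k by (simp add: orbit_fixer_def)
  have kak: "k \<otimes> ?a \<otimes> inv k \<in> P" using P.inv_op_closed2[OF kG a(1)] .
  obtain u :: nat where u: "\<And>y. y \<in> orb P x \<Longrightarrow> \<phi> (k \<otimes> ?a \<otimes> inv k) y = \<phi> (?a [^] u) y"
    using P_on_orb[OF x kak] by metis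
  have 1: "\<phi> k (\<phi> ?a y) = \<phi> (?a [^] u) (\<phi> k y)" if y: "y \<in> orb P x" for y
  proof -
    have yE: "y \<in> E" using orb_P_closed[OF x y] .
    have "\<phi> (k \<otimes> ?a \<otimes> inv k) (\<phi> k y) = \<phi> k (\<phi> ?a y)"
      using a kG yE by (simp add: composition_rule act_closed act_inv)
    then show ?thesis using u[OF orbit_fixer_orb[OF P.is_subgroup k x y]] by simp
  qed
  have "\<phi> k (\<phi> (?a [^] n) y) = \<phi> (?a [^] (u * n)) (\<phi> k y)" if y: "y \<in> orb P x" for n :: nat and y
  proof (induction n)
    case 0
    have "y \<in> E" using orb_P_closed[OF x y] .
    then show ?case using kG by (simp add: act_one act_closed)
  next
    case (Suc n)
    have yE: "y \<in> E" using orb_P_closed[OF x y] .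
    have z: "\<phi> (?a [^] n) y \<in> orb P x"
      using orbit_fixer_orb[OF P.is_subgroup _ x y] subset_orbit_fixer[OF P.is_subgroup] pow_P[OF a(1)]
      by blast
    have "\<phi> k (\<phi> (?a [^] Suc n) y) = \<phi> k (\<phi> ?a (\<phi> (?a [^] n) y))"
      using act_pow_add[OF a(2) yE, of 1 n] a(2) by simp
    also have "\<dots> = \<phi> (?a [^] u) (\<phi> (?a [^] (u * n)) (\<phi> k y))"
      using 1[OF z] Suc by simp
    also have "\<dots> = \<phi> (?a [^] (u * Suc n)) (\<phi> k y)"
      using act_pow_add[OF a(2), of "\<phi> k y" u "u * n"] kG yE by (simp add: act_closed)
    finally show ?case .
  qed
  \<comment> \<open>Otherwise \<open>k\<close> would send both \<open>x\<close> and its image under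
    \<open>gen x\<close> to the same point.\<close>
  moreover have "\<not> q dvd u"
  proof
    assume "q dvd u"
    then have "\<phi> (?a [^] u) (\<phi> k x) = \<phi> k x"
      using act_pow_mod[OF a(1) act_closed[OF kG x], of u] act_one[OF act_closed[OF kG x]]
      by (simp add: mod_eq_0_iff_dvd)
    then have "\<phi> k (\<phi> ?a x) = \<phi> k x" using 1[OF orb_self[OF P.is_subgroup x]] by simp
    then show False using gen(2)[OF x] kG a x by (simp add: act_cancel act_closed)
  qed
  ultimately show thesis using that by blast
qed

section \<open>Embedding into a power of the holomorph\<close>

definition label_perm :: "'c \<Rightarrow> 'a \<Rightarrow> int \<Rightarrow> int"
  where "label_perm x k i = int (idx x (\<phi> k (lab x (nat i))))"

text \<open>With \<open>c\<close> the label of \<open>\<phi> k x\<close>, moving \<open>k\<close>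
  past the \<open>n\<close>-th power of the generator shows that the point labelled \<open>n\<close>
  goes to the one labelled \<open>u * n + c\<close>.\<close>

lemma affine_label_perm:
  assumes x: "x \<in> E" and k: "k \<in> orbit_fixer P"
  shows "affine_perm q (label_perm x k)"
proof -
  have kG: "k \<in> carrier G" using k by (simp add: orbit_fixer_def)
  obtain u :: nat where u: "\<not> q dvd u"
    "\<And>(n::nat) y. y \<in> orb P x \<Longrightarrow> \<phi> k (\<phi> (gen x [^] n) y) = \<phi> (gen x [^] (u * n)) (\<phi> k y)"
    using fixer_on_orb[OF x k] by blast
  have xx: "x \<in> orb P x" by (rule orb_self[OF P.is_subgroup x])
  define c where "c = idx x (\<phi> k x)"
  have c: "\<phi> k x = \<phi> (gen x [^] c) x"
    using lab_idx[OF x orbit_fixer_orb[OF P.is_subgroup k x xx]] by (simp add: c_def lab_def)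
  have "\<phi> k (lab x n) = lab x (u * n + c)" for n
    using u(2)[OF xx, of n] c act_pow_add[of "gen x" x "u * n" c] gen(1)[OF x] x
    by (simp add: lab_def)
  then have "label_perm x k i = (int u * i + int c) mod int q" if "i \<in> {0..<int q}" for i
    using that by (simp add: label_perm_def idx_lab[OF x] zmod_int)
  moreover have "\<not> int q dvd int u" using u(1) by simp
  ultimately show ?thesis unfolding affine_perm_def by blast
qed

lemma label_perm_mult:
  assumes x: "x \<in> E" and k: "k \<in> orbit_fixer P" and l: "l \<in> orbit_fixer P"
  shows "label_perm x (k \<otimes> l) i = label_perm x k (label_perm x l i)"
proof -
  have "\<phi> l (lab x (nat i)) \<in> orb P x"
    by (rule orbit_fixer_orb[OF P.is_subgroup l x lab_in_orb[OF x]])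
  moreover have "k \<in> carrier G" "l \<in> carrier G" "lab x (nat i) \<in> E"
    using k l orb_P_closed[OF x lab_in_orb[OF x]] by (simp_all add: orbit_fixer_def)
  ultimately show ?thesis by (simp add: label_perm_def lab_idx[OF x] composition_rule)
qed

lemma label_perm_id_iff:
  assumes x: "x \<in> E" and k: "k \<in> orbit_fixer P"
  shows "(\<forall>i\<in>{0..<int q}. label_perm x k i = i) \<longleftrightarrow> (\<forall>y\<in>orb P x. \<phi> k y = y)"
proof
  assume id: "\<forall>i\<in>{0..<int q}. label_perm x k i = i"
  show "\<forall>y\<in>orb P x. \<phi> k y = y"
  proof
    fix y assume y: "y \<in> orb P x"
    have "label_perm x k (int (idx x y)) = int (idx x y)"
      using id idx_less[OF x y] by simp
    then have "idx x (\<phi> k y) = idx x y" by (simp add: label_perm_def lab_idx[OF x y])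
    then show "\<phi> k y = y"
      using lab_idx[OF x y] lab_idx[OF x orbit_fixer_orb[OF P.is_subgroup k x y]] by simp
  qed
next
  assume "\<forall>y\<in>orb P x. \<phi> k y = y"
  then show "\<forall>i\<in>{0..<int q}. label_perm x k i = i"
    using lab_in_orb[OF x] by (auto simp: label_perm_def idx_lab[OF x] zmod_int)
qed

lemma act_kernel_subset_fixer: "act_kernel \<subseteq> orbit_fixer P"
  using act_kernel_subset_centralizer[OF normal_P] act_centralizerD(1) by blast

text \<open>The label permutations on all \<open>P\<close>-orbits are collected into one
  homomorphism. An element is in its kernel when it fixes every point of every orbit, and the orbits
  cover \<open>E\<close>, so the first isomorphism theorem applies.\<close>

proposition fixer_Mod_kernel_embeds:
  assumes m: "m = card (orbits (G\<lparr>carrier := P\<rparr>) E \<phi>)"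
  defines "H \<equiv> product_group {..<m} (\<lambda>_. holomorph (integer_mod_group q))"
  shows "\<exists>S. subgroup S H \<and> (G\<lparr>carrier := orbit_fixer P\<rparr>) Mod act_kernel \<cong> H\<lparr>carrier := S\<rparr>"
proof -
  let ?B = "orbits (G\<lparr>carrier := P\<rparr>) E \<phi>" and ?F = "G\<lparr>carrier := orbit_fixer P\<rparr>"
  let ?hol = "holomorph (integer_mod_group q)"
  have "finite ?B" using finite_set by (simp add: orbits_def)
  \<comment> \<open>The product is indexed by \<open>{..<m}\<close>, so the orbits are numbered;
    below, \<open>b j\<close> is a base point of the \<open>j\<close>-th orbit and fixes its
    labelling.\<close>
  then obtain \<beta> where \<beta>: "bij_betw \<beta> {..<m} ?B"
    using m ex_bij_betw_nat_finite by (metis atLeast0LessThan)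
  have "\<forall>j\<in>{..<m}. \<exists>x. x \<in> E \<and> \<beta> j = orb P x"
    using bij_betwE[OF \<beta>] by (auto simp: orbits_def)
  then obtain b where b: "\<And>j. j < m \<Longrightarrow> b j \<in> E \<and> \<beta> j = orb P (b j)" by (metis lessThan_iff)
  have hol: "group ?hol" by (rule group.group_holomorph) simp
  then interpret H: group H by (simp add: H_def)
  have F: "subgroup (orbit_fixer P) G" using normal_orbit_fixer[OF normal_P] normal_imp_subgroup by blast
  then interpret F: group ?F by (rule subgroup_imp_group)
  define \<Psi> where "\<Psi> k = (\<lambda>j\<in>{..<m}. affine_hol q (label_perm (b j) k))" for k
  have aff: "affine_perm q (label_perm (b j) k)" if "k \<in> orbit_fixer P" "j < m" for j k
    using affine_label_perm b that by blast
  interpret group_hom ?F H \<Psi>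
  proof (unfold_locales, rule homI)
    fix k assume "k \<in> carrier ?F"
    then show "\<Psi> k \<in> carrier H"
      using affine_hol_closed[OF prime_q] aff by (auto simp: H_def \<Psi>_def)
    fix l assume "l \<in> carrier ?F"
    with \<open>k \<in> carrier ?F\<close> have kl: "k \<in> orbit_fixer P" "l \<in> orbit_fixer P" by simp_all
    have "affine_hol q (label_perm (b j) (k \<otimes> l))
        = affine_hol q (label_perm (b j) k) \<otimes>\<^bsub>?hol\<^esub> affine_hol q (label_perm (b j) l)" if "j < m" for j
      using that kl b label_perm_mult by (intro affine_hol_mult[OF prime_q] aff) auto
    then show "\<Psi> (k \<otimes>\<^bsub>?F\<^esub> l) = \<Psi> k \<otimes>\<^bsub>H\<^esub> \<Psi> l"
      by (auto simp: H_def \<Psi>_def)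
  qed
  have "kernel ?F H \<Psi> = act_kernel"
  proof -
    have "\<Psi> k = \<one>\<^bsub>H\<^esub> \<longleftrightarrow> k \<in> act_kernel" if k: "k \<in> orbit_fixer P" for k
    proof -
      have "\<Psi> k = \<one>\<^bsub>H\<^esub> \<longleftrightarrow> (\<forall>j<m. affine_hol q (label_perm (b j) k) = \<one>\<^bsub>?hol\<^esub>)"
        by (auto simp: H_def \<Psi>_def fun_eq_iff)
      also have "\<dots> \<longleftrightarrow> (\<forall>j<m. \<forall>y\<in>\<beta> j. \<phi> k y = y)"
        using affine_hol_eq_one_iff[OF prime_q] aff[OF k] label_perm_id_iff[OF _ k] b by simp
      also have "\<dots> \<longleftrightarrow> (\<forall>y\<in>\<Union>(\<beta> ` {..<m}). \<phi> k y = y)" by auto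
      also have "\<Union>(\<beta> ` {..<m}) = E"
        using \<beta> group_action.orbits_coverture[OF induced_action[OF P.is_subgroup]]
        by (simp add: bij_betw_def)
      finally show ?thesis using k by (simp add: act_kernel_def orbit_fixer_def)
    qed
    then show ?thesis using act_kernel_subset_fixer by (auto simp: kernel_def)
  qed
  moreover have S: "subgroup (\<Psi> ` carrier ?F) H" by (rule img_is_subgroup)
  moreover have "?F Mod kernel ?F H \<Psi> \<cong> H\<lparr>carrier := \<Psi> ` carrier ?F\<rparr>"
  proof -
    \<comment> \<open>The isomorphism theorem asks for a surjective map, so the codomain is cut down
      to the image, which does not change the kernel.\<close>
    have "\<Psi> \<in> hom ?F (H\<lparr>carrier := \<Psi> ` carrier ?F\<rparr>)"
      using homh by (simp add: hom_def)
    then interpret I: group_hom ?F "H\<lparr>carrier := \<Psi> ` carrier ?F\<rparr>" \<Psi>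
      using H.subgroup_imp_group[OF S]
      by (intro group_hom.intro group_hom_axioms.intro F.is_group)
    have "kernel ?F (H\<lparr>carrier := \<Psi> ` carrier ?F\<rparr>) \<Psi> = kernel ?F H \<Psi>" by (simp add: kernel_def)
    then show ?thesis using I.FactGroup_iso by simp
  qed
  ultimately show ?thesis by metis
qed

section \<open>The centralizer modulo the kernel as a Sylow subgroup\<close>

lemma P_subset_centralizer: "P \<subseteq> act_centralizer P"
  using subset_orbit_fixer[OF P.is_subgroup] act_commute by (blast intro: act_centralizerI)

text \<open>At each point \<open>y\<close> the element \<open>k\<close> agrees with some
  \<open>p\<close> in \<open>P\<close> depending on \<open>y\<close>. Powers of \<open>k\<close>
  commute with \<open>p\<close> on \<open>E\<close>, so \<open>k [^] n\<close> and
  \<open>p [^] n\<close> agree at \<open>y\<close> for all \<open>n\<close>, in particular for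
  \<open>n = q\<close>.\<close>

lemma centralizer_exponent:
  assumes "k \<in> act_centralizer P"
  shows "k [^] q \<in> act_kernel"
proof -
  interpret T: normal "act_centralizer P" G by (rule normal_act_centralizer[OF normal_P])
  have kG: "k \<in> carrier G" using assms by simp
  have "\<phi> (k [^] q) y = y" if y: "y \<in> E" for y
  proof -
    have "\<phi> k y \<in> orb P y" using act_centralizerD(1)[OF assms] y by (simp add: orbit_fixer_def)
    then obtain p where p: "p \<in> P" "\<phi> k y = \<phi> p y" by (auto simp: orb_iff)
    have pG: "p \<in> carrier G" using p by simp
    have "\<phi> (k [^] n) y = \<phi> (p [^] n) y" for n :: nat
    proof (induction n)
      case (Suc n)
      have kn: "k [^] n \<in> act_centralizer P"
        using assms by (induction n) (auto intro: T.m_closed)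
      have "\<phi> (k [^] Suc n) y = \<phi> (k [^] n) (\<phi> p y)"
        using kG y p by (simp add: composition_rule)
      also have "\<dots> = \<phi> p (\<phi> (p [^] n) y)"
        using act_centralizerD(3)[OF kn p(1) y] Suc by simp
      also have "\<dots> = \<phi> (p [^] Suc n) y"
        using act_pow_add[OF pG y, of 1 n] pG by simp
      finally show ?case .
    qed simp
    then show ?thesis using act_exponent[OF p(1) y] by simp
  qed
  then show ?thesis using kG by (simp add: act_kernel_def)
qed

text \<open>If \<open>k\<close> multiplies the labels of an orbit by \<open>u\<close>, then \<open>k [^] q\<close> multiplies them by
  \<open>u ^ q\<close>, which is congruent to \<open>u\<close>.\<close>

lemma centralizer_if_pow:
  assumes k: "k \<in> orbit_fixer P" and kq: "k [^] q \<in> act_centralizer P"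
  shows "k \<in> act_centralizer P"
proof (rule act_centralizerI[OF k])
  fix p x assume p: "p \<in> P" and x: "x \<in> E"
  let ?a = "gen x"
  have a: "?a \<in> P" "?a \<in> carrier G" using gen(1)[OF x] by simp_all
  have kG: "k \<in> carrier G" using k by (simp add: orbit_fixer_def)
  interpret F: normal "orbit_fixer P" G by (rule normal_orbit_fixer[OF normal_P])
  have xx: "x \<in> orb P x" by (rule orb_self[OF P.is_subgroup x])
  obtain u :: nat where u: "\<not> q dvd u"
    "\<And>(n::nat) y. y \<in> orb P x \<Longrightarrow> \<phi> k (\<phi> (?a [^] n) y) = \<phi> (?a [^] (u * n)) (\<phi> k y)"
    using fixer_on_orb[OF x k] by blast
  have kn: "k [^] n \<in> orbit_fixer P" for n :: nat
    using k by (induction n) (auto intro: F.m_closed)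
  have conj: "\<phi> (k [^] n) (\<phi> ?a x) = \<phi> (?a [^] (u ^ n)) (\<phi> (k [^] n) x)" for n :: nat
  proof (induction n)
    case 0
    then show ?case using a x by (simp add: act_one act_closed)
  next
    case (Suc n)
    have kx: "\<phi> (k [^] n) x \<in> orb P x" by (rule orbit_fixer_orb[OF P.is_subgroup kn x xx])
    have pow: "\<phi> (k [^] Suc n) y = \<phi> k (\<phi> (k [^] n) y)" if "y \<in> E" for y
      using act_pow_add[OF kG that, of 1 n] kG by simp
    show ?case
      using u(2)[OF kx, of "u ^ n"] Suc pow[OF x] pow[OF act_closed[OF a(2) x]] by simp
  qed
  let ?z = "\<phi> (k [^] q) x"
  have z: "?z \<in> orb P x" by (rule orbit_fixer_orb[OF P.is_subgroup kn x xx])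
  \<comment> \<open>By assumption the \<open>q\<close>-th power of \<open>k\<close> commutes with
    the generator, so its multiplier \<open>u ^ q\<close> must be 1 modulo \<open>q\<close>.\<close>
  have "\<phi> (?a [^] (u ^ q)) ?z = \<phi> (?a [^] (1::nat)) ?z"
    using conj[of q] act_centralizerD(3)[OF kq a(1) x] a(2) by simp
  then have "[u ^ q = 1] (mod q)"
    using act_pow_eq_iff[OF a(1) orb_P_closed[OF x z] gen_moves[OF x z]] by blast
  moreover have "[u ^ q = u] (mod q)"
  proof -
    \<comment> \<open>Fermat's theorem concerns the exponent \<open>q - 1\<close>; one more factor
      \<open>u\<close> raises it to \<open>q\<close>.\<close>
    have "[u * u ^ (q - 1) = u * 1] (mod q)"
      by (rule cong_scalar_left[OF fermat_theorem[OF prime_q u(1)]])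
    then show ?thesis using q_pos by (simp flip: power_Suc)
  qed
  ultimately have u1: "[u = 1] (mod q)" by (metis cong_sym cong_trans)
  obtain n :: nat where n: "\<And>y. y \<in> orb P x \<Longrightarrow> \<phi> p y = \<phi> (?a [^] n) y"
    using P_on_orb[OF x p] by metis
  have kx: "\<phi> k x \<in> orb P x" by (rule orbit_fixer_orb[OF P.is_subgroup k x xx])
  \<comment> \<open>Once \<open>u\<close> is 1 modulo \<open>q\<close>, \<open>k\<close> commutes on
    this orbit with all powers of the generator, and \<open>p\<close> acts there as such a
    power.\<close>
  have "[u * n = n] (mod q)" using cong_scalar_right[OF u1, of n] by simp
  then have "\<phi> (?a [^] (u * n)) (\<phi> k x) = \<phi> (?a [^] n) (\<phi> k x)"
    using act_pow_eq_iff[OF a(1) orb_P_closed[OF x kx] gen_moves[OF x kx]] by blast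
  then show "\<phi> k (\<phi> p x) = \<phi> p (\<phi> k x)"
    using u(2)[OF xx, of n] n[OF xx] n[OF kx] by simp
qed

lemma order_Mod_mult:
  assumes "N \<lhd> G" "subgroup M G" "N \<subseteq> M"
  shows "order (G\<lparr>carrier := M\<rparr> Mod N) * card N = card M"
proof -
  interpret M: group "G\<lparr>carrier := M\<rparr>" by (rule subgroup_imp_group[OF assms(2)])
  have "subgroup N (G\<lparr>carrier := M\<rparr>)"
    using normal_restrict_supergroup[OF assms(2,1,3)] by (rule normal_imp_subgroup)
  from M.lagrange[OF this] show ?thesis by (simp add: order_def FactGroup_def)
qed

text \<open>The order of \<open>Q\<close> is the product of the orders of \<open>F / T\<close> and
  \<open>T / K\<close>, where \<open>T / K\<close> has \<open>q\<close>-power order and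
  \<open>q\<close> does not divide the order of \<open>F / T\<close>.\<close>

proposition sylow_centralizer_Mod_kernel:
  defines "Q \<equiv> (G\<lparr>carrier := orbit_fixer P\<rparr>) Mod act_kernel"
  shows "q dvd order Q" (is ?dvd)
    and "sylow_subgroup Q q (carrier ((G\<lparr>carrier := act_centralizer P\<rparr>) Mod act_kernel))" (is ?sylow)
proof -
  let ?T = "act_centralizer P" and ?F = "orbit_fixer P" and ?K = act_kernel
  have T: "?T \<lhd> G" by (rule normal_act_centralizer[OF normal_P])
  have F: "?F \<lhd> G" by (rule normal_orbit_fixer[OF normal_P])
  note Ts = normal_imp_subgroup[OF T] and Fs = normal_imp_subgroup[OF F]
  have KT: "?K \<subseteq> ?T" by (rule act_kernel_subset_centralizer[OF normal_P])
  have TF: "?T \<subseteq> ?F" using act_centralizerD(1) by blast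
  have fin: "finite ?T" "finite ?F" "finite ?K"
    using finite_group Ts Fs finite_subset subgroup.subset KT TF by metis+
  have KnT: "?K \<lhd> G\<lparr>carrier := ?T\<rparr>" by (rule normal_restrict_supergroup[OF Ts normal_act_kernel KT])
  have TnF: "?T \<lhd> G\<lparr>carrier := ?F\<rparr>" by (rule normal_restrict_supergroup[OF Fs T TF])
  obtain a where a: "order (G\<lparr>carrier := ?T\<rparr> Mod ?K) = q ^ a"
    using normal.order_Mod_exponent_prime[OF KnT _ prime_q] fin(1) centralizer_exponent
    by (auto simp flip: nat_pow_consistent)
  have nd: "\<not> q dvd order (G\<lparr>carrier := ?F\<rparr> Mod ?T)"
    using normal.not_dvd_order_Mod[OF TnF _ prime_q] fin(2) centralizer_if_pow
    by (auto simp flip: nat_pow_consistent)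
  have K0: "card ?K > 0"
    using fin(3) subgroup.one_closed[OF normal_imp_subgroup[OF normal_act_kernel]]
    by (auto simp: card_gt_0_iff)
  \<comment> \<open>Lagrange is applied to each of the three quotients, and the common factor
    \<open>card ?K\<close> is then cancelled.\<close>
  have "order Q * card ?K = (order (G\<lparr>carrier := ?F\<rparr> Mod ?T) * q ^ a) * card ?K"
    using order_Mod_mult[OF normal_act_kernel Ts KT] order_Mod_mult[OF T Fs TF]
      order_Mod_mult[OF normal_act_kernel Fs] KT TF a by (simp add: Q_def mult.assoc)
  then have ord: "order Q = order (G\<lparr>carrier := ?F\<rparr> Mod ?T) * q ^ a" using K0 by simp
  \<comment> \<open>If \<open>T / K\<close> were trivial, then \<open>P\<close>, being contained in
    \<open>T\<close>, would act trivially, although each of its orbits has \<open>q\<close>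
    points.\<close>
  have "a \<noteq> 0"
  proof
    assume "a = 0"
    then have "card ?K = card ?T" using order_Mod_mult[OF normal_act_kernel Ts KT] a by simp
    then have "?K = ?T" using card_subset_eq[OF fin(1) KT] by simp
    then have PK: "P \<subseteq> ?K" using P_subset_centralizer by simp
    obtain x where "x \<in> E" using nonempty by blast
    then show False using ex_moving[of x] PK by (auto simp: act_kernel_def)
  qed
  then show ?dvd using ord by simp
  have "\<not> q ^ Suc a dvd order Q"
    using nd ord q_pos by simp
  moreover have "subgroup (carrier ((G\<lparr>carrier := ?T\<rparr>) Mod ?K)) Q"
  proof -
    have "subgroup ?T (G\<lparr>carrier := ?F\<rparr>)" by (rule normal_imp_subgroup[OF TnF])
    from group.normal_subgroup_factorize[OF subgroup_imp_group[OF Fs]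
        normal_restrict_supergroup[OF Fs normal_act_kernel act_kernel_subset_fixer] KT this]
    show ?thesis by (simp add: Q_def FactGroup_def)
  qed
  ultimately show ?sylow using a unfolding sylow_subgroup_def order_def by blast
qed

end

section \<open>Solvable groups of squarefree degree\<close>

context finite_transitive_action
begin

lemma act_kernelD: "g \<in> act_kernel \<Longrightarrow> x \<in> E \<Longrightarrow> \<phi> g x = x"
  by (simp add: act_kernel_def)

lemma act_kernelI: "g \<in> carrier G \<Longrightarrow> (\<And>x. x \<in> E \<Longrightarrow> \<phi> g x = x) \<Longrightarrow> g \<in> act_kernel"
  by (simp add: act_kernel_def)

section \<open>Construction of the elementary abelian action\<close>

lemma act_commute_if_derived:
  assumes N: "N \<subseteq> carrier G" and der: "derived G N \<subseteq> act_kernel"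
    and a: "a \<in> N" and b: "b \<in> N" and x: "x \<in> E"
  shows "\<phi> a (\<phi> b x) = \<phi> b (\<phi> a x)"
proof -
  have G: "a \<in> carrier G" "b \<in> carrier G" using a b N by auto
  have "a \<otimes> b \<otimes> inv a \<otimes> inv b \<in> derived G N"
    unfolding derived_def using a b by (intro generate.incl) blast
  then have "a \<otimes> b \<otimes> inv a \<otimes> inv b \<in> act_kernel" using der by blast
  \<comment> \<open>Applied after \<open>b \<otimes> a\<close>, the commutator produces
    \<open>a \<otimes> b\<close>.\<close>
  then have "\<phi> (a \<otimes> b \<otimes> inv a \<otimes> inv b) (\<phi> (b \<otimes> a) x) = \<phi> (b \<otimes> a) x"
    using G x by (intro act_kernelD) (auto simp: act_closed)
  then show ?thesis using G x by (simp add: composition_rule act_closed act_inv)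
qed

lemma ex_normal_commuting_act:
  assumes solv: "solvable G" and card: "card E > 1"
  obtains N where "N \<lhd> G" "\<not> N \<subseteq> act_kernel"
    "\<And>a b x. a \<in> N \<Longrightarrow> b \<in> N \<Longrightarrow> x \<in> E \<Longrightarrow> \<phi> a (\<phi> b x) = \<phi> b (\<phi> a x)"
proof -
  define D where "D n = (derived G ^^ n) (carrier G)" for n
  have normD: "D n \<lhd> G" for n
  proof (induction n)
    case 0
    show ?case unfolding D_def by (simp add: normal_self)
  next
    case (Suc n)
    then show ?case unfolding D_def by (simp add: derived_is_normal)
  qed
  obtain n where "D n = {\<one>}"
    using solv unfolding solvable_iff_trivial_derived_seq D_def by blast
  then have n: "D n \<subseteq> act_kernel"
    using subgroup.one_closed[OF normal_imp_subgroup[OF normal_act_kernel]] by simp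
  define l where "l = (LEAST n. D n \<subseteq> act_kernel)"
  have l: "D l \<subseteq> act_kernel" unfolding l_def using n by (rule LeastI)
  \<comment> \<open>A transitive group on at least two points moves something, so the least index
    \<open>l\<close> is positive; its predecessor gives the required subgroup.\<close>
  have "\<not> D 0 \<subseteq> act_kernel"
  proof
    assume "D 0 \<subseteq> act_kernel"
    then have "x = y" if "x \<in> E" "y \<in> E" for x y
      using unique_orbit[OF that] act_kernelD[OF _ that(1)] by (force simp: D_def)
    then have "card E \<le> 1" using finite_set by (simp add: card_le_Suc0_iff_eq)
    then show False using card by simp
  qed
  then have "l \<noteq> 0" using l by metis
  then obtain m where m: "l = Suc m" using not0_implies_Suc by blast
  have "\<not> D m \<subseteq> act_kernel" using not_less_Least[of m "\<lambda>n. D n \<subseteq> act_kernel"] m unfolding l_def by simp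
  moreover have "derived G (D m) \<subseteq> act_kernel" using l m by (simp add: D_def)
  ultimately show thesis
    using that[OF normD[of m]] act_commute_if_derived[OF subgroup.subset[OF normal_imp_subgroup[OF normD]]]
    by blast
qed

text \<open>Elements of \<open>N\<close> commute only modulo the kernel, so the two expressions are
  compared as maps on \<open>E\<close>; in \<open>G\<close> they may differ.\<close>

lemma act_pow_mult_distrib:
  assumes N: "subgroup N G"
    and comm: "\<And>a b x. a \<in> N \<Longrightarrow> b \<in> N \<Longrightarrow> x \<in> E \<Longrightarrow> \<phi> a (\<phi> b x) = \<phi> b (\<phi> a x)"
    and a: "a \<in> N" and b: "b \<in> N" and x: "x \<in> E"
  shows "\<phi> ((a \<otimes> b) [^] (n::nat)) x = \<phi> (a [^] n) (\<phi> (b [^] n) x)"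
proof (induction n)
  case 0
  then show ?case by (simp add: act_one x)
next
  case (Suc n)
  have pow: "c [^] (n::nat) \<in> N" if "c \<in> N" for c n
    using that by (induction n) (simp_all add: subgroup.one_closed[OF N] subgroup.m_closed[OF N])
  have G: "a \<in> carrier G" "b \<in> carrier G" using subgroup.mem_carrier[OF N] a b by blast+
  have ab: "a \<otimes> b \<in> N" by (rule subgroup.m_closed[OF N a b])
  have "\<phi> ((a \<otimes> b) [^] Suc n) x = \<phi> (a \<otimes> b) (\<phi> ((a \<otimes> b) [^] n) x)"
    using comm[OF pow[OF ab] ab x] G x by (simp add: composition_rule)
  also have "\<dots> = \<phi> a (\<phi> b (\<phi> (a [^] n) (\<phi> (b [^] n) x)))"
    using Suc G x by (simp add: composition_rule act_closed)
  also have "\<dots> = \<phi> a (\<phi> (a [^] n) (\<phi> b (\<phi> (b [^] n) x)))"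
    using comm[OF b pow[OF a]] G x by (simp add: act_closed)
  also have "\<dots> = \<phi> (a [^] Suc n) (\<phi> (b [^] Suc n) x)"
    using comm[OF a pow[OF a], of "\<phi> b (\<phi> (b [^] n) x)" n] comm[OF b pow[OF b] x] G x
    by (simp add: composition_rule act_closed)
  finally show ?case .
qed

lemma act_pow_conj:
  assumes "g \<in> carrier G" "a \<in> carrier G" "x \<in> E"
  shows "\<phi> ((g \<otimes> a \<otimes> inv g) [^] (n::nat)) x = \<phi> g (\<phi> (a [^] n) (\<phi> (inv g) x))"
  using assms(3)
proof (induction n arbitrary: x)
  case 0
  then show ?case using assms by (simp add: act_one act_inv' act_closed)
next
  case (Suc n)
  then show ?case using assms by (simp add: composition_rule act_closed act_inv)
qed

text \<open>Closure under products is the point where the commutativity of the action enters: it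
  makes taking \<open>q\<close>-th powers multiplicative modulo the kernel.\<close>

lemma exponent_part_normal:
  assumes N: "N \<lhd> G"
    and comm: "\<And>a b x. a \<in> N \<Longrightarrow> b \<in> N \<Longrightarrow> x \<in> E \<Longrightarrow> \<phi> a (\<phi> b x) = \<phi> b (\<phi> a x)"
  shows "{a \<in> N. a [^] (q::nat) \<in> act_kernel} \<lhd> G"
proof (rule normal_invI)
  interpret N: normal N G by (rule N)
  interpret K: normal act_kernel G by (rule normal_act_kernel)
  show "subgroup {a \<in> N. a [^] q \<in> act_kernel} G"
  proof (rule subgroupI)
    have "\<one> \<in> {a \<in> N. a [^] q \<in> act_kernel}" by simp
    then show "{a \<in> N. a [^] q \<in> act_kernel} \<noteq> {}" by blast
    fix a assume a: "a \<in> {a \<in> N. a [^] q \<in> act_kernel}"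
    then show "inv a \<in> {a \<in> N. a [^] q \<in> act_kernel}" by (simp add: nat_pow_inv)
    fix b assume b: "b \<in> {a \<in> N. a [^] q \<in> act_kernel}"
    have "\<phi> ((a \<otimes> b) [^] q) x = x" if "x \<in> E" for x
      using act_pow_mult_distrib[OF N.is_subgroup comm _ _ that, of a b q] a b that
      by (simp add: act_kernelD)
    then have "(a \<otimes> b) [^] q \<in> act_kernel" using a b by (intro act_kernelI) auto
    then show "a \<otimes> b \<in> {a \<in> N. a [^] q \<in> act_kernel}" using a b by simp
  qed auto
  fix g a assume g: "g \<in> carrier G" and a: "a \<in> {a \<in> N. a [^] q \<in> act_kernel}"
  have "\<phi> ((g \<otimes> a \<otimes> inv g) [^] q) x = x" if "x \<in> E" for x
    using act_pow_conj[OF g _ that, of a q] a g that by (simp add: act_kernelD act_closed act_inv')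
  then have "(g \<otimes> a \<otimes> inv g) [^] q \<in> act_kernel" using a g by (intro act_kernelI) auto
  then show "g \<otimes> a \<otimes> inv g \<in> {a \<in> N. a [^] q \<in> act_kernel}"
    using a N.inv_op_closed2[OF g] by simp
qed

lemma ex_prime_order_mod_kernel:
  assumes p: "p \<in> carrier G" "p \<notin> act_kernel"
  obtains q r :: nat where "Factorial_Ring.prime q" "p [^] r \<notin> act_kernel" "(p [^] r) [^] q \<in> act_kernel"
proof -
  interpret K: normal act_kernel G by (rule normal_act_kernel)
  \<comment> \<open>The least \<open>k\<close> satisfying \<open>P\<close> is the order of
    \<open>p\<close> modulo the kernel; for a prime divisor \<open>q\<close> of it, the exponent
    \<open>r = k / q\<close> leaves an element of order \<open>q\<close>.\<close>
  define P where "P k \<longleftrightarrow> k > 0 \<and> p [^] k \<in> act_kernel" for k :: nat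
  have "P (order G)"
    using pow_order_eq_1[OF p(1)] finite_group by (simp add: P_def order_gt_0_iff_finite)
  then have k: "P (LEAST k. P k)" by (rule LeastI)
  define k where "k = (LEAST k. P k)"
  have "k \<noteq> 1" using k p by (auto simp: P_def k_def)
  then obtain q where q: "Factorial_Ring.prime q" "q dvd k" using prime_factor_nat by blast
  then obtain r where r: "k = r * q" by (metis dvdE mult.commute)
  have kP: "k > 0" "p [^] k \<in> act_kernel" using k by (simp_all add: P_def k_def)
  then have "0 < r" "r < k" using r prime_gt_1_nat[OF q(1)] by auto
  then have "p [^] r \<notin> act_kernel" using not_less_Least[of r P] by (simp add: P_def k_def)
  moreover have "(p [^] r) [^] q \<in> act_kernel" using kP r p by (simp add: nat_pow_pow)
  ultimately show thesis using that q by blast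
qed

text \<open>Commutativity makes the stabilizer of \<open>x\<close> normal in \<open>P\<close>. The
  orbit length is its index, hence the order of a quotient group of exponent dividing
  \<open>q\<close>.\<close>

lemma card_orb_prime_power:
  assumes P: "P \<lhd> G" and q: "Factorial_Ring.prime q" and x: "x \<in> E"
    and comm: "\<And>a b x. a \<in> P \<Longrightarrow> b \<in> P \<Longrightarrow> x \<in> E \<Longrightarrow> \<phi> a (\<phi> b x) = \<phi> b (\<phi> a x)"
    and exp: "\<And>a x. a \<in> P \<Longrightarrow> x \<in> E \<Longrightarrow> \<phi> (a [^] q) x = x"
  obtains a where "card (orb P x) = q ^ a"
proof -
  interpret P: normal P G by (rule P)
  let ?P = "G\<lparr>carrier := P\<rparr>"
  interpret A: group_action ?P E \<phi> by (rule induced_action[OF P.is_subgroup])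
  interpret GP: group ?P by (rule subgroup_imp_group[OF P.is_subgroup])
  let ?S = "stabilizer ?P \<phi> x"
  have S: "subgroup ?S ?P" by (rule A.stabilizer_subgroup[OF x])
  have "?S \<lhd> ?P"
  proof (rule GP.normal_invI[OF S])
    fix g s assume g: "g \<in> carrier ?P" and s: "s \<in> ?S"
    have gs: "g \<in> P" "s \<in> P" "\<phi> s x = x" using g s by (auto simp: stabilizer_def)
    have "\<phi> (g \<otimes> s \<otimes> inv g) x = \<phi> g (\<phi> s (\<phi> (inv g) x))"
      using gs x by (simp add: composition_rule act_closed)
    also have "\<dots> = x"
      using comm[OF gs(2) P.m_inv_closed[OF gs(1)] x] gs x by (simp add: act_inv')
    finally show "g \<otimes>\<^bsub>?P\<^esub> s \<otimes>\<^bsub>?P\<^esub> inv\<^bsub>?P\<^esub> g \<in> ?S"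
      using gs by (simp add: stabilizer_def m_inv_consistent[OF P.is_subgroup])
  qed
  then interpret S: normal ?S ?P .
  have fin: "finite P" using finite_group P.subset finite_subset by blast
  have "g [^]\<^bsub>?P\<^esub> q \<in> ?S" if "g \<in> carrier ?P" for g
    using that exp[OF _ x] GP.nat_pow_closed[of g q]
    by (simp add: stabilizer_def flip: nat_pow_consistent)
  then obtain a where a: "order (?P Mod ?S) = q ^ a"
    using S.order_Mod_exponent_prime[OF _ q] fin by auto
  have "card (orb P x) * card ?S = q ^ a * card ?S"
    using A.orbit_stabilizer_theorem[OF x] GP.lagrange[OF S] a
    by (simp add: order_def FactGroup_def)
  moreover have "card ?S > 0"
    using fin subgroup.one_closed[OF S] subgroup.subset[OF S] finite_subset by (fastforce simp: card_gt_0_iff)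
  ultimately show thesis using that by simp
qed

proposition ex_elementary_abelian_action:
  assumes solv: "solvable G" and card: "card E > 1" and sqf: "squarefree (card E)"
  obtains P q where "elementary_abelian_action G E \<phi> P q"
proof -
  obtain N where N: "N \<lhd> G" "\<not> N \<subseteq> act_kernel"
    and comm: "\<And>a b x. a \<in> N \<Longrightarrow> b \<in> N \<Longrightarrow> x \<in> E \<Longrightarrow> \<phi> a (\<phi> b x) = \<phi> b (\<phi> a x)"
    using ex_normal_commuting_act[OF solv card] by metis
  interpret N: normal N G by (rule N(1))
  obtain p where p: "p \<in> N" "p \<notin> act_kernel" using N(2) by blast
  obtain q r :: nat where q: "Factorial_Ring.prime q"
    and r: "p [^] r \<notin> act_kernel" "(p [^] r) [^] q \<in> act_kernel"
    using ex_prime_order_mod_kernel[of p] p by auto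
  define P where "P = {a \<in> N. a [^] q \<in> act_kernel}"
  have nP: "P \<lhd> G" unfolding P_def by (rule exponent_part_normal[OF N(1) comm])
  have commP: "\<phi> a (\<phi> b x) = \<phi> b (\<phi> a x)" if "a \<in> P" "b \<in> P" "x \<in> E" for a b x
    using comm that by (simp add: P_def)
  have expP: "\<phi> (a [^] q) x = x" if "a \<in> P" "x \<in> E" for a x
    using that by (simp add: P_def act_kernelD)
  have "p [^] r \<in> N" using p by (induction r) auto
  then have rP: "p [^] r \<in> P" using r by (simp add: P_def)
  obtain y where y: "y \<in> E" "\<phi> (p [^] r) y \<noteq> y"
    using r(1) p by (auto simp: act_kernel_def)
  have E: "E \<noteq> {}" using card by auto
  have "card (orb P x) = q" if x: "x \<in> E" for x
  proof -
    obtain a where a: "card (orb P x) = q ^ a"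
      using card_orb_prime_power[OF nP q x] commP expP by metis
    \<comment> \<open>All \<open>P\<close>-orbits have the same length because \<open>G\<close> is
      transitive, and the orbit of \<open>y\<close> has at least two points.\<close>
    have "a \<noteq> 0"
    proof
      assume "a = 0"
      then have "card (orb P y) = 1" using a card_orb_eq[OF nP x y(1)] by simp
      moreover have "y \<in> orb P y" "\<phi> (p [^] r) y \<in> orb P y"
        using orb_self[OF normal_imp_subgroup[OF nP] y(1)] rP by (auto simp: orb_iff)
      ultimately show False using y(2) by (metis card_1_singletonE singletonD)
    qed
    \<comment> \<open>The orbit length divides \<open>card E\<close>, so it inherits squarefreeness,
      which leaves only the exponent 1.\<close>
    moreover have "squarefree (q ^ a)"
      using squarefree_mono[OF _ sqf] card_orb_mult_card_orbits[OF nP x] a by (metis dvd_triv_right)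
    ultimately have "a = 1" using prime_gt_1_nat[OF q] by (simp add: squarefree_power_iff)
    then show ?thesis using a by simp
  qed
  then have "elementary_abelian_action G E \<phi> P q"
    using nP q commP expP E
    by (intro elementary_abelian_action.intro elementary_abelian_action_axioms.intro
        finite_transitive_action_axioms)
  then show thesis using that by blast
qed

section \<open>The induced action on the orbits of a normal subgroup\<close>

lemma block_action:
  assumes N: "N \<lhd> G"
  defines "\<B> \<equiv> orbits (G\<lparr>carrier := N\<rparr>) E \<phi>"
  shows "finite_transitive_action G \<B> (\<lambda>g. \<lambda>B\<in>\<B>. \<phi> g ` B)"
proof -
  \<comment> \<open>The restriction to \<open>\<B>\<close> makes each map extensional, as membership
    in \<open>Bij \<B>\<close> requires.\<close>
  let ?\<psi> = "\<lambda>g. \<lambda>B\<in>\<B>. \<phi> g ` B"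
  have Ns: "N \<subseteq> carrier G" using normal_imp_subgroup[OF N] subgroup.subset by blast
  have BE: "B \<subseteq> E" if "B \<in> \<B>" for B
    using that orb_closed[OF Ns] by (auto simp: \<B>_def orbits_def)
  have closed: "\<phi> g ` B \<in> \<B>" if "g \<in> carrier G" "B \<in> \<B>" for g B
    using that act_image_orb[OF N that(1)] act_closed[OF that(1)]
    by (force simp: \<B>_def orbits_def)
  have comp: "\<phi> (g \<otimes> h) ` B = \<phi> g ` \<phi> h ` B" if "g \<in> carrier G" "h \<in> carrier G" "B \<in> \<B>" for g h B
    using BE[OF that(3)] that(1,2) by (auto simp: image_image composition_rule subset_eq intro!: image_cong)
  have one: "\<phi> \<one> ` B = B" if "B \<in> \<B>" for B
    using BE[OF that] act_one by (simp add: subset_eq)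
  have bij: "?\<psi> g \<in> Bij \<B>" if g: "g \<in> carrier G" for g
  proof -
    have "bij_betw (?\<psi> g) \<B> \<B>"
    proof (rule bij_betw_byWitness[where f' = "?\<psi> (inv g)"])
      show "\<forall>B\<in>\<B>. ?\<psi> (inv g) (?\<psi> g B) = B"
        using g closed[OF g] comp[of "inv g" g] one by simp
      show "\<forall>B\<in>\<B>. ?\<psi> g (?\<psi> (inv g) B) = B"
        using g closed[of "inv g"] comp[of g "inv g"] one by simp
    qed (use g closed in auto)
    then show ?thesis by (simp add: Bij_def)
  qed
  have hom: "?\<psi> \<in> hom G (BijGroup \<B>)"
    using bij comp closed by (auto simp: hom_def BijGroup_def compose_def fun_eq_iff)
  have trans: "\<exists>g\<in>carrier G. ?\<psi> g B = C" if BC: "B \<in> \<B>" "C \<in> \<B>" for B C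
  proof -
    obtain x y where xy: "x \<in> E" "y \<in> E" "B = orb N x" "C = orb N y"
      using BC by (auto simp: \<B>_def orbits_def)
    then obtain g where g: "g \<in> carrier G" "\<phi> g x = y" using unique_orbit by blast
    then have "?\<psi> g B = C" using act_image_orb[OF N g(1) xy(1)] xy BC by simp
    then show ?thesis using g(1) by blast
  qed
  have "finite \<B>" using finite_set by (simp add: \<B>_def orbits_def)
  with hom trans show ?thesis
    by (intro finite_transitive_action.intro transitive_action.intro group_action.intro
        transitive_action_axioms.intro finite_transitive_action_axioms.intro group_hom.intro
        group_hom_axioms.intro is_group group_BijGroup finite_group)
qed

end

section \<open>The tower\<close>

context finite_transitive_action
begin

text \<open>One step of the chain from \<open>K\<close> to \<open>F\<close>. The number of factors
  is given as the number of \<open>F\<close>-orbits; its arithmetic value is supplied only when the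
  whole tower is counted.\<close>

definition tower_layer :: "'a set \<Rightarrow> 'a set \<Rightarrow> 'a set \<Rightarrow> nat \<Rightarrow> bool"
  where "tower_layer K T F q \<longleftrightarrow>
    (let m = card (orbits (G\<lparr>carrier := F\<rparr>) E \<phi>);
         H = product_group {..<m} (\<lambda>_. holomorph (integer_mod_group q));
         Q = (G\<lparr>carrier := F\<rparr>) Mod K
     in T \<lhd> G \<and> K \<subseteq> T \<and> T \<subseteq> F \<and> orbit_fixer T = F
        \<and> (\<exists>S. subgroup S H \<and> Q \<cong> H\<lparr>carrier := S\<rparr>)
        \<and> q dvd order Q \<and> sylow_subgroup Q q (carrier ((G\<lparr>carrier := T\<rparr>) Mod K)))"

text \<open>The condition \<open>orbit_fixer K = K\<close> says that \<open>K\<close> is the kernel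
  of the action on its own orbits, so results on quotients by the kernel of the block action become
  results on quotients by \<open>K\<close>. The new group \<open>F\<close> satisfies the same
  condition, which allows iteration.\<close>

proposition tower_step:
  assumes solv: "solvable G" and K: "K \<lhd> G" and fixK: "orbit_fixer K = K"
  defines "\<B> \<equiv> orbits (G\<lparr>carrier := K\<rparr>) E \<phi>"
  assumes card: "card \<B> > 1" and sqf: "squarefree (card \<B>)"
  obtains q T F where "Factorial_Ring.prime q" "F \<lhd> G" "orbit_fixer F = F"
    "card (orbits (G\<lparr>carrier := F\<rparr>) E \<phi>) * q = card \<B>" "tower_layer K T F q"
proof -
  let ?\<psi> = "\<lambda>g. \<lambda>B\<in>\<B>. \<phi> g ` B"
  interpret K: normal K G by (rule K)
  interpret B: finite_transitive_action G \<B> ?\<psi> unfolding \<B>_def by (rule block_action[OF K])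
  obtain P q where "elementary_abelian_action G \<B> ?\<psi> P q"
    using B.ex_elementary_abelian_action[OF solv card sqf] .
  then interpret EA: elementary_abelian_action G \<B> ?\<psi> P q .
  have psi: "?\<psi> g (orb K x) = orb K (\<phi> g x)" if "g \<in> carrier G" "x \<in> E" for g x
    using act_image_orb[OF K that] that(2) by (auto simp: \<B>_def orbits_def)
  have in_B: "orb K x \<in> \<B>" if "x \<in> E" for x using that by (auto simp: \<B>_def orbits_def)
  have B_E: "\<exists>x\<in>E. B = orb K x" if "B \<in> \<B>" for B using that by (auto simp: \<B>_def orbits_def)
  have orb_K_eq_iff: "orb K x = orb K y \<longleftrightarrow> x \<in> orb K y" if "x \<in> E" "y \<in> E" for x y
    using orb_eq[OF K.is_subgroup that(2)] orb_self[OF K.is_subgroup that(1)] by blast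
  let ?T = "B.act_centralizer P" and ?F = "B.orbit_fixer P"
  have kernel: "B.act_kernel = K"
  proof -
    have "B.act_kernel = {g \<in> carrier G. \<forall>x\<in>E. orb K (\<phi> g x) = orb K x}"
      using psi in_B B_E unfolding B.act_kernel_def by (force simp del: restrict_apply)
    also have "\<dots> = orbit_fixer K"
      using orb_K_eq_iff act_closed unfolding orbit_fixer_def by blast
    finally show ?thesis using fixK by simp
  qed
  have T: "?T \<lhd> G" by (rule B.normal_act_centralizer[OF EA.normal_P])
  have F: "?F \<lhd> G" by (rule B.normal_orbit_fixer[OF EA.normal_P])
  note Ts = normal_imp_subgroup[OF T] and Fs = normal_imp_subgroup[OF F]
  have KT: "K \<subseteq> ?T" using B.act_kernel_subset_centralizer[OF EA.normal_P] kernel by simp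
  have TF: "?T \<subseteq> ?F" using B.act_centralizerD(1) by blast
  \<comment> \<open>Every group between \<open>T\<close> and \<open>F\<close> has the same orbits on
    \<open>E\<close>, namely the unions of the \<open>K\<close>-orbits that form one
    \<open>P\<close>-orbit of blocks. The cases \<open>M = T\<close> and \<open>M = F\<close> are
    both needed.\<close>
  have orb_M: "y \<in> orb M x \<longleftrightarrow> y \<in> E \<and> orb K y \<in> B.orb P (orb K x)"
    if M: "subgroup M G" "?T \<subseteq> M" "M \<subseteq> ?F" and x: "x \<in> E" for M x y
  proof
    assume "y \<in> orb M x"
    then obtain t where t: "t \<in> M" "y = \<phi> t x" by (auto simp: orb_iff)
    have tF: "t \<in> ?F" using t(1) M(3) by blast
    have tG: "t \<in> carrier G" by (rule subgroup.mem_carrier[OF Fs tF])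
    have "?\<psi> t (orb K x) \<in> B.orb P (orb K x)"
      using tF in_B[OF x] unfolding B.orbit_fixer_def by blast
    then show "y \<in> E \<and> orb K y \<in> B.orb P (orb K x)"
      using psi[OF tG x] t(2) act_closed[OF tG x] by simp
  next
    assume y: "y \<in> E \<and> orb K y \<in> B.orb P (orb K x)"
    then obtain p where p: "p \<in> P" "orb K y = ?\<psi> p (orb K x)" unfolding B.orb_iff by blast
    have pM: "p \<in> M" "p \<in> carrier G" using p(1) EA.P_subset_centralizer M(2) by auto
    have "orb K y = orb K (\<phi> p x)" using p(2) psi[OF pM(2) x] by simp
    then have "y \<in> orb K (\<phi> p x)" using orb_K_eq_iff y act_closed[OF pM(2) x] by blast
    then obtain k where k: "k \<in> K" "y = \<phi> k (\<phi> p x)" by (auto simp: orb_iff)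
    \<comment> \<open>An element of \<open>P\<close> first reaches the right block, then one of
      \<open>K\<close> moves inside it; both lie in \<open>T\<close>.\<close>
    have "k \<otimes> p \<in> M" using k(1) KT M(2) pM(1) subgroup.m_closed[OF M(1)] by blast
    moreover have "y = \<phi> (k \<otimes> p) x" using k pM(2) x by (simp add: composition_rule)
    ultimately show "y \<in> orb M x" unfolding orb_iff by blast
  qed
  have fixM: "orbit_fixer M = ?F" if M: "subgroup M G" "?T \<subseteq> M" "M \<subseteq> ?F" for M
  proof -
    have "orbit_fixer M = {g \<in> carrier G. \<forall>x\<in>E. orb K (\<phi> g x) \<in> B.orb P (orb K x)}"
      using orb_M[OF M] act_closed unfolding orbit_fixer_def by blast
    also have "\<dots> = {g \<in> carrier G. \<forall>x\<in>E. ?\<psi> g (orb K x) \<in> B.orb P (orb K x)}"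
      using psi by (auto simp del: restrict_apply)
    also have "\<dots> = ?F" using in_B B_E unfolding B.orbit_fixer_def by blast
    finally show ?thesis .
  qed
  let ?BP = "orbits (G\<lparr>carrier := P\<rparr>) \<B> ?\<psi>"
  have union: "\<Union>(B.orb P (orb K x)) = orb ?F x" if x: "x \<in> E" for x
  proof -
    have "y \<in> \<Union>(B.orb P (orb K x)) \<longleftrightarrow> y \<in> E \<and> orb K y \<in> B.orb P (orb K x)" for y
    proof
      assume "y \<in> \<Union>(B.orb P (orb K x))"
      then obtain C where C: "C \<in> B.orb P (orb K x)" "y \<in> C" by blast
      then obtain z where z: "z \<in> E" "C = orb K z"
        using B_E EA.orb_P_closed[OF in_B[OF x]] by blast
      have y: "y \<in> E" using C(2) z orb_closed[OF K.subset z(1)] by simp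
      then have "orb K y = C" using orb_K_eq_iff[OF y z(1)] z(2) C(2) by simp
      then show "y \<in> E \<and> orb K y \<in> B.orb P (orb K x)" using y C(1) by simp
    next
      assume "y \<in> E \<and> orb K y \<in> B.orb P (orb K x)"
      then show "y \<in> \<Union>(B.orb P (orb K x))" using orb_self[OF K.is_subgroup] by blast
    qed
    then show ?thesis using orb_M[OF Fs TF subset_refl x] by blast
  qed
  \<comment> \<open>Taking unions matches the \<open>P\<close>-orbits of blocks with the
    \<open>F\<close>-orbits of points, so both are equally many.\<close>
  have "bij_betw Union ?BP (orbits (G\<lparr>carrier := ?F\<rparr>) E \<phi>)"
  proof (rule bij_betw_imageI)
    show "inj_on Union ?BP"
    proof (rule inj_onI)
      fix C D assume CD: "C \<in> ?BP" "D \<in> ?BP" "\<Union>C = \<Union>D"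
      obtain x y where x: "x \<in> E" "C = B.orb P (orb K x)" and y: "y \<in> E" "D = B.orb P (orb K y)"
        using CD B_E unfolding orbits_def by blast
      have "x \<in> orb ?F y" using CD(3) union x y orb_self[OF Fs x(1)] by simp
      then have "orb K x \<in> B.orb P (orb K y)" using orb_M[OF Fs TF subset_refl y(1)] by blast
      then show "C = D" using B.orb_eq[OF EA.P.is_subgroup in_B[OF y(1)]] x(2) y(2) by simp
    qed
    have "?BP = (\<lambda>x. B.orb P (orb K x)) ` E"
      using in_B B_E unfolding orbits_def by blast
    then show "Union ` ?BP = orbits (G\<lparr>carrier := ?F\<rparr>) E \<phi>"
      using union by (auto simp: orbits_def image_image)
  qed
  then have cardF: "card (orbits (G\<lparr>carrier := ?F\<rparr>) E \<phi>) = card ?BP"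
    using bij_betw_same_card by metis
  obtain b where "b \<in> \<B>" using EA.nonempty by blast
  then have count: "card (orbits (G\<lparr>carrier := ?F\<rparr>) E \<phi>) * q = card \<B>"
    using B.card_orb_mult_card_orbits[OF EA.normal_P] EA.card_orb cardF by metis
  have "tower_layer K ?T ?F q"
    unfolding tower_layer_def Let_def
    using T KT TF fixM[OF Ts subset_refl TF] EA.fixer_Mod_kernel_embeds[OF cardF, unfolded kernel]
      EA.sylow_centralizer_Mod_kernel[unfolded kernel] by (intro conjI)
  then show thesis by (rule that[OF EA.prime_q F fixM[OF Fs TF subset_refl] count])
qed

lemma orbit_fixer_act_kernel: "orbit_fixer act_kernel = act_kernel"
proof -
  have "orb act_kernel x = {x}" if "x \<in> E" for x
    using that orb_self[OF normal_imp_subgroup[OF normal_act_kernel] that]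
    by (auto simp: orb_iff act_kernelD)
  then show ?thesis by (auto simp: orbit_fixer_def act_kernel_def)
qed

lemma card_orbits_act_kernel: "card (orbits (G\<lparr>carrier := act_kernel\<rparr>) E \<phi>) = card E"
proof (cases "E = {}")
  case False
  then obtain x where x: "x \<in> E" by blast
  have "orb act_kernel x = {x}"
    using x orb_self[OF normal_imp_subgroup[OF normal_act_kernel] x]
    by (auto simp: orb_iff act_kernelD)
  then show ?thesis using card_orb_mult_card_orbits[OF normal_act_kernel x] by simp
qed (simp add: orbits_def)

text \<open>This ends the tower: a group with a single orbit that equals its own orbit fixer is all
  of \<open>G\<close>.\<close>

lemma orbit_fixer_one_orbit:
  assumes "subgroup N G" "card (orbits (G\<lparr>carrier := N\<rparr>) E \<phi>) = 1"
  shows "orbit_fixer N = carrier G"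
proof -
  obtain B where B: "orbits (G\<lparr>carrier := N\<rparr>) E \<phi> = {B}"
    using assms(2) by (rule card_1_singletonE)
  have "orb N x = B" if "x \<in> E" for x using B that by (auto simp: orbits_def)
  then have "\<phi> g x \<in> orb N x" if "g \<in> carrier G" "x \<in> E" for g x
    using orb_self[OF assms(1) act_closed[OF that]] act_closed[OF that] that(2) by simp
  then show ?thesis by (auto simp: orbit_fixer_def)
qed

section \<open>Iteration of the step\<close>

definition partial_tower ::
    "nat \<Rightarrow> (nat \<Rightarrow> nat) \<Rightarrow> (nat \<Rightarrow> 'a set) \<Rightarrow> (nat \<Rightarrow> 'a set) \<Rightarrow> bool"
  where "partial_tower i q K T \<longleftrightarrow> K 0 = act_kernel
    \<and> (\<forall>j\<le>i. K j \<lhd> G \<and> orbit_fixer (K j) = K j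
        \<and> card (orbits (G\<lparr>carrier := K j\<rparr>) E \<phi>) * (\<Prod>k\<in>{1..j}. q k) = card E)
    \<and> (\<forall>j\<in>{1..i}. tower_layer (K (j - 1)) (T j) (K j) (q j))"

text \<open>Only finitely many values matter, so the three sequences may be changed at
  \<open>Suc i\<close> without disturbing the tower already built.\<close>

lemma partial_tower_cong:
  assumes "partial_tower i q K T" "\<And>j. j \<in> {1..i} \<Longrightarrow> q' j = q j"
    "\<And>j. j \<le> i \<Longrightarrow> K' j = K j" "\<And>j. j \<in> {1..i} \<Longrightarrow> T' j = T j"
  shows "partial_tower i q' K' T'"
proof -
  have "(\<Prod>k\<in>{1..j}. q' k) = (\<Prod>k\<in>{1..j}. q k)" if "j \<le> i" for j
    using that assms(2) by (intro prod.cong) auto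
  then show ?thesis using assms unfolding partial_tower_def by auto
qed

lemma partial_tower_Suc:
  assumes "partial_tower i q K T" "K (Suc i) \<lhd> G" "orbit_fixer (K (Suc i)) = K (Suc i)"
    "card (orbits (G\<lparr>carrier := K (Suc i)\<rparr>) E \<phi>) * q (Suc i) = card (orbits (G\<lparr>carrier := K i\<rparr>) E \<phi>)"
    "tower_layer (K i) (T (Suc i)) (K (Suc i)) (q (Suc i))"
  shows "partial_tower (Suc i) q K T"
proof -
  have "card (orbits (G\<lparr>carrier := K (Suc i)\<rparr>) E \<phi>) * (\<Prod>k\<in>{1..Suc i}. q k)
      = card (orbits (G\<lparr>carrier := K i\<rparr>) E \<phi>) * (\<Prod>k\<in>{1..i}. q k)"
    using assms(4) by (simp add: prod.nat_ivl_Suc' mult_ac flip: assms(4))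
  also have "\<dots> = card E" using assms(1) by (simp add: partial_tower_def)
  finally show ?thesis
    using assms unfolding partial_tower_def by (auto simp: le_Suc_eq atLeastAtMostSuc_conv)
qed

text \<open>The prime of each step cannot be prescribed. It is recognised afterwards as one of the
  primes not yet used, because the number of remaining orbits is the product of exactly these
  primes; \<open>s\<close> records the resulting order.\<close>

proposition ex_partial_tower:
  fixes p :: "nat \<Rightarrow> nat"
  assumes solv: "solvable G"
    and primes: "\<forall>i\<in>{1..n}. Factorial_Ring.prime (p i)" and inj: "inj_on p {1..n}"
    and cardE: "card E = (\<Prod>i\<in>{1..n}. p i)"
  shows "i \<le> n \<Longrightarrow> \<exists>s K T. inj_on s {1..i} \<and> s ` {1..i} \<subseteq> {1..n} \<and> partial_tower i (p \<circ> s) K T"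
proof (induction i)
  case 0
  have "partial_tower 0 (p \<circ> id) (\<lambda>_. act_kernel) (\<lambda>_. {})"
    by (simp add: partial_tower_def normal_act_kernel orbit_fixer_act_kernel card_orbits_act_kernel)
  then show ?case by (intro exI[of _ id] exI conjI) simp_all
next
  case (Suc i)
  then obtain s K T where s: "inj_on s {1..i}" "s ` {1..i} \<subseteq> {1..n}"
    and tower: "partial_tower i (p \<circ> s) K T" using Suc_leD by blast
  have p0: "p l \<noteq> 0" if "l \<in> {1..n}" for l using primes that not_prime_0 by metis
  let ?R = "{1..n} - s ` {1..i}" and ?M = "card (orbits (G\<lparr>carrier := K i\<rparr>) E \<phi>)"
  have K: "K i \<lhd> G" "orbit_fixer (K i) = K i" "?M * (\<Prod>k\<in>{1..i}. p (s k)) = card E"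
    using tower by (simp_all add: partial_tower_def)
  have "(\<Prod>k\<in>{1..i}. p (s k)) = (\<Prod>l\<in>s ` {1..i}. p l)"
    using prod.reindex[OF s(1), of p] by simp
  then have eq: "?M * (\<Prod>l\<in>s ` {1..i}. p l) = (\<Prod>l\<in>?R. p l) * (\<Prod>l\<in>s ` {1..i}. p l)"
    using K(3) cardE prod.subset_diff[OF s(2), of p] by simp
  have "p l \<noteq> 0" if "l \<in> s ` {1..i}" for l using that s(2) p0 by blast
  then have "(\<Prod>l\<in>s ` {1..i}. p l) \<noteq> 0" by (simp add: prod_zero_iff)
  then have M: "?M = (\<Prod>l\<in>?R. p l)" using eq mult_right_cancel by blast
  have "card (s ` {1..i}) < card {1..n}" using card_image[OF s(1)] Suc.prems by simp
  then have "?R \<noteq> {}" using card_mono[of "s ` {1..i}" "{1..n}"] by auto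
  then obtain l where l: "l \<in> ?R" by blast
  have "p l dvd ?M" unfolding M using l by (intro dvd_prodI) auto
  moreover have "?M \<noteq> 0" unfolding M using p0 by (simp add: prod_zero_iff)
  moreover have "p l > 1" using primes l prime_gt_1_nat by blast
  ultimately have M1: "?M > 1" by (meson dvd_imp_le less_le_trans not_gr_zero)
  have "coprime (p a) (p b)" if "a \<in> ?R" "b \<in> ?R" "a \<noteq> b" for a b
    using that primes inj_onD[OF inj, of a b] primes_coprime[of "p a" "p b"] by blast
  then have sqf: "squarefree ?M"
    unfolding M using primes by (intro squarefree_prod_coprime squarefree_prime) blast+
  obtain q T' F where q: "Factorial_Ring.prime q" and F: "F \<lhd> G" "orbit_fixer F = F"
    "card (orbits (G\<lparr>carrier := F\<rparr>) E \<phi>) * q = ?M" "tower_layer (K i) T' F q"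
    using tower_step[OF solv K(1,2) M1 sqf] by metis
  have "q dvd (\<Prod>l\<in>?R. p l)" using F(3) M by (metis dvd_triv_right)
  then obtain l where l: "l \<in> ?R" "q dvd p l"
    using q by (auto simp: prime_dvd_prod_iff)
  then have ql: "q = p l" using q primes primes_dvd_imp_eq by blast
  let ?s = "s(Suc i := l)" and ?K = "K(Suc i := F)" and ?T = "T(Suc i := T')"
  have "partial_tower i (p \<circ> ?s) ?K ?T" by (rule partial_tower_cong[OF tower]) auto
  then have "partial_tower (Suc i) (p \<circ> ?s) ?K ?T"
    by (rule partial_tower_Suc) (use F ql in simp_all)
  moreover have img: "?s ` {1..i} = s ` {1..i}" by (intro image_cong) auto
  have ins: "{1..Suc i} = insert (Suc i) {1..i}" by auto
  have "inj_on ?s {1..i}" using s(1) by (subst inj_on_cong[of _ ?s s]) auto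
  then have "inj_on ?s (insert (Suc i) {1..i})"
    using l(1) img by (simp add: inj_on_insert)
  then have "inj_on ?s {1..Suc i}" by (simp only: ins)
  moreover have "?s ` {1..Suc i} \<subseteq> {1..n}"
  proof -
    have "?s ` {1..Suc i} = insert l (?s ` {1..i})"
      by (simp only: ins image_insert fun_upd_same)
    also have "\<dots> \<subseteq> {1..n}" using img s(2) l(1) by simp
    finally show ?thesis .
  qed
  ultimately show ?case by blast
qed

end

section \<open>Permutation groups and the assembly of the tower\<close>

lemma permutation_action:
  assumes G: "subgroup G (BijGroup \<Omega>)" and fin: "finite \<Omega>"
    and trans: "\<forall>x\<in>\<Omega>. \<forall>y\<in>\<Omega>. \<exists>g\<in>G. g x = y"
  shows "finite_transitive_action ((BijGroup \<Omega>)\<lparr>carrier := G\<rparr>) \<Omega> (\<lambda>g. g)"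
proof -
  have "group ((BijGroup \<Omega>)\<lparr>carrier := G\<rparr>)"
    by (rule group.subgroup_imp_group[OF group_BijGroup G])
  moreover have "(\<lambda>g. g) \<in> hom ((BijGroup \<Omega>)\<lparr>carrier := G\<rparr>) (BijGroup \<Omega>)"
    using subgroup.mem_carrier[OF G] by (simp add: hom_def)
  moreover have "finite G"
  proof (rule finite_subset)
    show "G \<subseteq> \<Omega> \<rightarrow>\<^sub>E \<Omega>"
    proof
      fix g assume "g \<in> G"
      then have "g \<in> Bij \<Omega>" using subgroup.mem_carrier[OF G] by (simp add: BijGroup_def)
      then show "g \<in> \<Omega> \<rightarrow>\<^sub>E \<Omega>"
        by (simp add: PiE_def Bij_imp_funcset Bij_imp_extensional)
    qed
  qed (simp add: finite_PiE fin)
  ultimately show ?thesis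
    using fin trans
    by (intro finite_transitive_action.intro transitive_action.intro group_action.intro
        transitive_action_axioms.intro finite_transitive_action_axioms.intro group_hom.intro
        group_hom_axioms.intro group_BijGroup) auto
qed

theorem theorem3p6:
  fixes n :: nat and p :: "nat \<Rightarrow> nat" and \<Omega> :: "'a set" and G :: "('a \<Rightarrow> 'a) set"
  assumes primes: "\<forall>i\<in>{1..n}. Factorial_Ring.prime (p i)"
    and distinct: "inj_on p {1..n}"
    and cardX: "card \<Omega> = (\<Prod>i\<in>{1..n}. p i)"
    and subgrp: "subgroup G (BijGroup \<Omega>)"
    and solv: "solvable ((BijGroup \<Omega>)\<lparr>carrier := G\<rparr>)"
    and trans: "\<forall>x\<in>\<Omega>. \<forall>y\<in>\<Omega>. \<exists>g\<in>G. g x = y"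
  shows "\<exists>\<sigma> K T. \<sigma> permutes {1..n}
    \<and> K 0 = {\<one>\<^bsub>BijGroup \<Omega>\<^esub>} \<and> K n = G
    \<and> (\<forall>i\<le>n. K i \<lhd> (BijGroup \<Omega>)\<lparr>carrier := G\<rparr>)
    \<and> (\<forall>i\<in>{1..n}. T i \<lhd> (BijGroup \<Omega>)\<lparr>carrier := G\<rparr> \<and> K (i - 1) \<subseteq> T i \<and> T i \<subseteq> K i)
    \<and> (\<forall>i\<in>{1..n}.
         let q = p (\<sigma> i);
             m = (\<Prod>j\<in>{1..n}. p j) div (\<Prod>j\<in>{1..i}. p (\<sigma> j));
             Q = ((BijGroup \<Omega>)\<lparr>carrier := K i\<rparr>) Mod K (i - 1)
         in (\<exists>S. subgroup S (product_group {..<m} (\<lambda>_. holomorph (integer_mod_group q)))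
                  \<and> Q \<cong> (product_group {..<m} (\<lambda>_. holomorph (integer_mod_group q)))\<lparr>carrier := S\<rparr>)
          \<and> q dvd order Q
          \<and> sylow_subgroup Q q (carrier (((BijGroup \<Omega>)\<lparr>carrier := T i\<rparr>) Mod K (i - 1)))
          \<and> K i = {g \<in> G. \<forall>x\<in>\<Omega>. g ` orbit_of (T i) x = orbit_of (T i) x}
          \<and> imprimitivity_system \<Omega> G {orbit_of (K i) x | x. x \<in> \<Omega>}
          \<and> card {orbit_of (K i) x | x. x \<in> \<Omega>} = m)"
proof -
  let ?G = "(BijGroup \<Omega>)\<lparr>carrier := G\<rparr>"
  have "p i \<noteq> 0" if "i \<in> {1..n}" for i using primes that not_prime_0 by metis
  then have prod0: "(\<Prod>i\<in>{1..n}. p i) \<noteq> 0" by (simp add: prod_zero_iff)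
  \<comment> \<open>An infinite set has cardinality 0 by convention, while a product of primes is
    nonzero.\<close>
  have fin: "finite \<Omega>" using cardX prod0 card.infinite by metis
  interpret A: finite_transitive_action ?G \<Omega> "\<lambda>g. g"
    by (rule permutation_action[OF subgrp fin trans])
  have orb: "A.orb N x = orbit_of N x" for N x by (auto simp: orbit_def orbit_of_def)
  have orbits: "orbits ((BijGroup \<Omega>)\<lparr>carrier := N\<rparr>) \<Omega> (\<lambda>g. g) = {orbit_of N x | x. x \<in> \<Omega>}" for N
    using orb[of N] by (simp add: orbits_def)
  have ext: "g \<in> extensional \<Omega>" if "g \<in> G" for g
    using subgroup.mem_carrier[OF subgrp that] by (simp add: BijGroup_def Bij_imp_extensional)
  \<comment> \<open>Elements of \<open>G\<close> are extensional on \<open>\<Omega>\<close>, so one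
    that fixes every point is the identity of \<open>BijGroup \<Omega>\<close>.\<close>
  have kernel: "A.act_kernel = {\<one>\<^bsub>BijGroup \<Omega>\<^esub>}"
  proof -
    have "\<one>\<^bsub>BijGroup \<Omega>\<^esub> \<in> A.act_kernel"
      using subgroup.one_closed[OF normal_imp_subgroup[OF A.normal_act_kernel]] by simp
    moreover have "g = \<one>\<^bsub>BijGroup \<Omega>\<^esub>" if "g \<in> A.act_kernel" for g
    proof -
      have g: "g \<in> G" "\<And>x. x \<in> \<Omega> \<Longrightarrow> g x = x" using that by (auto simp: A.act_kernel_def)
      show ?thesis using ext[OF g(1)] g(2) by (auto simp: BijGroup_def extensional_def fun_eq_iff)
    qed
    ultimately show ?thesis by blast
  qed
  obtain s K T where s: "inj_on s {1..n}" "s ` {1..n} \<subseteq> {1..n}"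
    and tower: "A.partial_tower n (p \<circ> s) K T"
    using A.ex_partial_tower[OF solv primes distinct cardX order_refl] by blast
  have K: "K i \<lhd> ?G" "card {orbit_of (K i) x | x. x \<in> \<Omega>} * (\<Prod>k\<in>{1..i}. p (s k)) = card \<Omega>"
    "A.orbit_fixer (K i) = K i" if "i \<le> n" for i
    using tower that orbits by (simp_all add: A.partial_tower_def)
  have layer: "A.tower_layer (K (i - 1)) (T i) (K i) (p (s i))" if "i \<in> {1..n}" for i
    using tower that by (simp add: A.partial_tower_def)
  have bij: "bij_betw s {1..n} {1..n}"
    using s by (simp add: bij_betw_def endo_inj_surj)
  \<comment> \<open>Nothing is known about \<open>s\<close> outside \<open>{1..n}\<close>, whereas
    \<open>permutes\<close> demands the identity there.\<close>
  define \<sigma> where "\<sigma> i = (if i \<in> {1..n} then s i else i)" for i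
  have perm: "\<sigma> permutes {1..n}"
  proof (rule bij_imp_permutes)
    show "bij_betw \<sigma> {1..n} {1..n}"
      using bij by (rule bij_betw_cong[THEN iffD1, rotated]) (simp add: \<sigma>_def)
  qed (auto simp: \<sigma>_def)
  have m: "(\<Prod>j\<in>{1..n}. p j) div (\<Prod>j\<in>{1..i}. p (\<sigma> j)) = card {orbit_of (K i) x | x. x \<in> \<Omega>}"
    if "i \<le> n" for i
  proof -
    have "(\<Prod>j\<in>{1..i}. p (\<sigma> j)) = (\<Prod>j\<in>{1..i}. p (s j))"
      using that by (intro prod.cong) (auto simp: \<sigma>_def)
    then have eq: "card {orbit_of (K i) x | x. x \<in> \<Omega>} * (\<Prod>j\<in>{1..i}. p (\<sigma> j)) = (\<Prod>j\<in>{1..n}. p j)"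
      using K(2)[OF that] cardX by (simp only:)
    have "(\<Prod>j\<in>{1..i}. p (\<sigma> j)) \<noteq> 0"
    proof
      assume "(\<Prod>j\<in>{1..i}. p (\<sigma> j)) = 0"
      then show False using eq prod0 by (simp only: mult_zero_right simp_thms)
    qed
    then show ?thesis unfolding eq[symmetric] by (rule nonzero_mult_div_cancel_right)
  qed
  have K0: "K 0 = {\<one>\<^bsub>BijGroup \<Omega>\<^esub>}" using tower kernel by (simp add: A.partial_tower_def)
  have Kn: "K n = G"
  proof -
    have reindex: "(\<Prod>j\<in>{1..n}. p (s j)) = (\<Prod>j\<in>{1..n}. p j)"
      by (rule prod.reindex_bij_betw[OF bij])
    \<comment> \<open>After \<open>n\<close> steps all primes are used up, so a single orbit
      remains.\<close>
    have "card {orbit_of (K n) x | x. x \<in> \<Omega>} * (\<Prod>j\<in>{1..n}. p j) = 1 * (\<Prod>j\<in>{1..n}. p j)"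
      using K(2)[OF order_refl] unfolding reindex cardX by (simp only: mult_1)
    then have "card {orbit_of (K n) x | x. x \<in> \<Omega>} = 1" using prod0 mult_right_cancel by blast
    then show ?thesis
      using A.orbit_fixer_one_orbit[OF normal_imp_subgroup[OF K(1)[OF order_refl]]] orbits
        K(3)[OF order_refl] by simp
  qed
  have imprim: "imprimitivity_system \<Omega> G {orbit_of (K i) x | x. x \<in> \<Omega>}" if "i \<le> n" for i
  proof -
    note Ki = normal_imp_subgroup[OF K(1)[OF that]]
    have part: "partition_on \<Omega> {orbit_of (K i) x | x. x \<in> \<Omega>}"
    proof (rule partition_onI)
      show "\<Union>{orbit_of (K i) x | x. x \<in> \<Omega>} = \<Omega>"
        using A.orb_self[OF Ki] A.orb_closed[OF subgroup.subset[OF Ki]] unfolding orb by blast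
      show "disjnt B C" if "B \<in> {orbit_of (K i) x | x. x \<in> \<Omega>}" "C \<in> {orbit_of (K i) x | x. x \<in> \<Omega>}"
        "B \<noteq> C" for B C
        using that A.orb_eq[OF Ki] unfolding orb disjnt_def by blast
      show "{} \<notin> {orbit_of (K i) x | x. x \<in> \<Omega>}"
        using A.orb_self[OF Ki] unfolding orb by blast
    qed
    have "g ` orbit_of (K i) x = orbit_of (K i) (g x)" if "g \<in> G" "x \<in> \<Omega>" for g x
      using A.act_image_orb[OF K(1)[OF \<open>i \<le> n\<close>], of g x, unfolded orb] that by simp
    moreover have "g x \<in> \<Omega>" if "g \<in> G" "x \<in> \<Omega>" for g x
      using A.act_closed[of g x] that by simp
    ultimately show ?thesis using part unfolding imprimitivity_system_def by blast
  qed
  have normals: "\<forall>i\<in>{1..n}. T i \<lhd> ?G \<and> K (i - 1) \<subseteq> T i \<and> T i \<subseteq> K i"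
    using layer unfolding A.tower_layer_def Let_def by blast
  have layers: "\<forall>i\<in>{1..n}.
         let q = p (\<sigma> i);
             m = (\<Prod>j\<in>{1..n}. p j) div (\<Prod>j\<in>{1..i}. p (\<sigma> j));
             Q = ((BijGroup \<Omega>)\<lparr>carrier := K i\<rparr>) Mod K (i - 1)
         in (\<exists>S. subgroup S (product_group {..<m} (\<lambda>_. holomorph (integer_mod_group q)))
                  \<and> Q \<cong> (product_group {..<m} (\<lambda>_. holomorph (integer_mod_group q)))\<lparr>carrier := S\<rparr>)
          \<and> q dvd order Q
          \<and> sylow_subgroup Q q (carrier (((BijGroup \<Omega>)\<lparr>carrier := T i\<rparr>) Mod K (i - 1)))
          \<and> K i = {g \<in> G. \<forall>x\<in>\<Omega>. g ` orbit_of (T i) x = orbit_of (T i) x}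
          \<and> imprimitivity_system \<Omega> G {orbit_of (K i) x | x. x \<in> \<Omega>}
          \<and> card {orbit_of (K i) x | x. x \<in> \<Omega>} = m" (is "\<forall>i\<in>_. ?layer i")
  proof
    fix i assume i: "i \<in> {1..n}"
    then have le: "i \<le> n" and \<sigma>: "\<sigma> i = s i" by (simp_all add: \<sigma>_def)
    have L: "T i \<lhd> ?G" "A.orbit_fixer (T i) = K i"
      using layer[OF i] by (simp_all add: A.tower_layer_def Let_def)
    \<comment> \<open>Normality of \<open>T i\<close> turns the pointwise definition of the orbit
      fixer into the setwise condition of (ii).\<close>
    have Ki: "K i = {g \<in> G. \<forall>x\<in>\<Omega>. g ` orbit_of (T i) x = orbit_of (T i) x}"
      using A.orbit_fixer_iff[OF L(1), unfolded orb] L(2) by simp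
    have upd: "?G\<lparr>carrier := N\<rparr> = (BijGroup \<Omega>)\<lparr>carrier := N\<rparr>" for N by simp
    note lay = layer[OF i, unfolded A.tower_layer_def Let_def upd orbits]
    have lay1: "\<exists>S. subgroup S (product_group {..<card {orbit_of (K i) x | x. x \<in> \<Omega>}}
          (\<lambda>_. holomorph (integer_mod_group (p (s i)))))
        \<and> ((BijGroup \<Omega>)\<lparr>carrier := K i\<rparr>) Mod K (i - 1)
          \<cong> (product_group {..<card {orbit_of (K i) x | x. x \<in> \<Omega>}}
              (\<lambda>_. holomorph (integer_mod_group (p (s i)))))\<lparr>carrier := S\<rparr>"
      using lay by (elim conjE)
    have lay2: "p (s i) dvd order (((BijGroup \<Omega>)\<lparr>carrier := K i\<rparr>) Mod K (i - 1))"
      using lay by (elim conjE)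
    have lay3: "sylow_subgroup (((BijGroup \<Omega>)\<lparr>carrier := K i\<rparr>) Mod K (i - 1)) (p (s i))
        (carrier (((BijGroup \<Omega>)\<lparr>carrier := T i\<rparr>) Mod K (i - 1)))"
      using lay by (elim conjE)
    show "?layer i"
      unfolding Let_def m[OF le] \<sigma> by (intro conjI lay1 lay2 lay3 Ki imprim[OF le] refl)
  qed
  have normal: "\<forall>i\<le>n. K i \<lhd> ?G" using K(1) by blast
  show ?thesis
    by (rule exI[of _ \<sigma>], rule exI[of _ K], rule exI[of _ T], intro conjI)
      (rule perm K0 Kn normal normals layers)+
qed

end
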